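(* The harmonic extension maps boundary values $\alpha\in C^{\infty}(B)$ to interior solutions $\Phi=\tilde\Phi(\alpha)$ of class $C^{\infty}(\mathrm{int}(B))$.
   Context: $U\subset\mathbb{R}^n$ is an open star-shaped set with the Euclidean metric, and $B\subset U$ is a regular (smooth) convex closed (hyper)surface (a two-point set if $n=1$) enclosing the region $\mathrm{int}(B)$; $j:B\hookrightarrow U$ is the inclusion. $V$ is a finite-dimensional vector space; data are functions (coefficients) with values in $V$. Harmonic extension: with the Laplace–Beltrami operator $\triangle=d\delta+\delta d$ (where $\delta$ is the codifferential), $\Phi=\tilde\Phi(\alpha)$ is the solution of $\triangle\Phi=0$ in $\mathrm{int}(B)$ with $j^*\Phi=\alpha$ on $B$. *)

theory Defs
  imports "HOL-Analysis.Analysis"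
begin

section \<open>Smooth functions\<close>

text \<open>The following notions are intended for open sets only.\<close>

primrec Ck_on ::
  "nat \<Rightarrow> ('a::real_normed_vector) set \<Rightarrow> ('a \<Rightarrow> 'b::real_normed_vector) \<Rightarrow> bool" where
  "Ck_on 0 S f \<longleftrightarrow> continuous_on S f"
| "Ck_on (Suc k) S f \<longleftrightarrow>
     (\<forall>x\<in>S. f differentiable (at x)) \<and> (\<forall>v. Ck_on k S (\<lambda>x. frechet_derivative f (at x) v))"

definition smooth_on ::
  "('a::real_normed_vector) set \<Rightarrow> ('a \<Rightarrow> 'b::real_normed_vector) \<Rightarrow> bool" where
  "smooth_on S f \<longleftrightarrow> (\<forall>k. Ck_on k S f)"


section \<open>Regular convex closed hypersurfaces\<close>

definition smooth_hypersurface :: "('a::euclidean_space) set \<Rightarrow> bool" where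
  "smooth_hypersurface B \<longleftrightarrow>
     (\<forall>p\<in>B. \<exists>W (g :: 'a \<Rightarrow> real). open W \<and> p \<in> W \<and> smooth_on W g \<and>
        (\<forall>x\<in>W. \<exists>v. frechet_derivative g (at x) v \<noteq> 0) \<and> B \<inter> W = {x \<in> W. g x = 0})"

text \<open>A closed hypersurface is compact without boundary, and it is convex if it bounds a
  (nonempty) convex region. The enclosed region is \<^term>\<open>inside B\<close>, the union
  of the bounded components of the complement of \<^term>\<open>B\<close>. On the real line this region is
  a bounded open interval, so that \<^term>\<open>B\<close> is a set of two points.\<close>

definition regular_convex_closed_hypersurface :: "('a::euclidean_space) set \<Rightarrow> bool" where
  "regular_convex_closed_hypersurface B \<longleftrightarrow>
     smooth_hypersurface B \<and> compact B \<and>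
     inside B \<noteq> {} \<and> convex (inside B) \<and> frontier (inside B) = B"

text \<open>For a submanifold \<^term>\<open>B\<close> embedded in Euclidean space, smoothness on \<^term>\<open>B\<close> is the existence
  of smooth local extensions; only the values of \<^term>\<open>\<alpha>\<close> on \<^term>\<open>B\<close> matter.\<close>

definition smooth_on_hypersurface ::
  "('a::euclidean_space) set \<Rightarrow> ('a \<Rightarrow> 'v::real_normed_vector) \<Rightarrow> bool" where
  "smooth_on_hypersurface B \<alpha> \<longleftrightarrow>
     (\<forall>p\<in>B. \<exists>W g. open W \<and> p \<in> W \<and> smooth_on W g \<and> (\<forall>x \<in> B \<inter> W. g x = \<alpha> x))"


section \<open>Differential forms and the Laplace--Beltrami operator\<close>

text \<open>A \<open>k\<close>-form is represented by its values on lists of \<open>k\<close> tangent vectors; it is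
  zero on lists of any other length.\<close>

type_synonym ('a, 'v) form = "'a \<Rightarrow> 'a list \<Rightarrow> 'v"

definition zero_form :: "('a \<Rightarrow> 'v::zero) \<Rightarrow> ('a, 'v) form" where
  "zero_form f = (\<lambda>x vs. if vs = [] then f x else 0)"

definition exterior_derivative ::
  "('a::euclidean_space, 'v::real_normed_vector) form \<Rightarrow> ('a, 'v) form" where
  "exterior_derivative \<omega> = (\<lambda>x vs. \<Sum>i<length vs.
     (-1) ^ i *\<^sub>R frechet_derivative (\<lambda>y. \<omega> y (take i vs @ drop (Suc i) vs)) (at x) (vs ! i))"

text \<open>For the Euclidean metric, the formal adjoint of the exterior derivative is minus the sum
  over an orthonormal basis of the contractions of the basis vectors with the corresponding
  partial derivatives. It vanishes on 0-forms.\<close>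

definition codifferential ::
  "('a::euclidean_space, 'v::real_normed_vector) form \<Rightarrow> ('a, 'v) form" where
  "codifferential \<omega> =
     (\<lambda>x vs. - (\<Sum>b\<in>Basis. frechet_derivative (\<lambda>y. \<omega> y (b # vs)) (at x) b))"

definition laplace_beltrami ::
  "('a::euclidean_space, 'v::real_normed_vector) form \<Rightarrow> ('a, 'v) form" where
  "laplace_beltrami \<omega> = (\<lambda>x vs.
     exterior_derivative (codifferential \<omega>) x vs + codifferential (exterior_derivative \<omega>) x vs)"

lemma laplace_beltrami_zero_form:
  "laplace_beltrami (zero_form f) x [] =
     - (\<Sum>b\<in>Basis. frechet_derivative (\<lambda>y. frechet_derivative f (at y) b) (at x) b)"
  by (simp add: laplace_beltrami_def exterior_derivative_def codifferential_def zero_form_def)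


section \<open>Harmonic extension\<close>

definition dirichlet_solution ::
  "('a::euclidean_space) set \<Rightarrow> ('a \<Rightarrow> 'v::real_normed_vector) \<Rightarrow> ('a \<Rightarrow> 'v) \<Rightarrow> bool" where
  "dirichlet_solution B \<alpha> \<Phi> \<longleftrightarrow>
     continuous_on (B \<union> inside B) \<Phi> \<and> Ck_on 2 (inside B) \<Phi> \<and>
     (\<forall>x \<in> inside B. laplace_beltrami (zero_form \<Phi>) x [] = 0) \<and>
     (\<forall>x \<in> B. \<Phi> x = \<alpha> x)"

text \<open>Functions are total, so values outside the closed region are normalised by
  \<^const>\<open>extensional\<close> to make the solution unique.\<close>

definition harmonic_extension ::
  "('a::euclidean_space) set \<Rightarrow> ('a \<Rightarrow> 'v::real_normed_vector) \<Rightarrow> 'a \<Rightarrow> 'v" where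
  "harmonic_extension B \<alpha> =
     (THE \<Phi>. dirichlet_solution B \<alpha> \<Phi> \<and> \<Phi> \<in> extensional (B \<union> inside B))"

end

theory Submission
  imports Defs
begin

text \<open>The Dirichlet problem is solved without integration, from the maximum principle alone.
  On a ball, a polynomial agrees on the sphere with a harmonic polynomial (an algebraic identity),
  so by Stone--Weierstrass and the maximum principle continuous boundary values are attained by a uniform
  limit of harmonic polynomials. A gradient bound, again obtained by comparison with a quadratic
  polynomial, shows that such limits are smooth. On the convex region, Perron's method applies: the
  supporting hyperplane at a boundary point gives a harmonic quadratic barrier with uniform constants.
  Comparing a subharmonic function with its own translates turns these barriers into a
  modulus of continuity for the supremum, so the supremum is itself the largest competitor
  and must be harmonic on every ball. Vector values are treated coordinatewise.\<close>

section \<open>The maximum principle\<close>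

text \<open>The algebra on the ball rests on one correction: the product of a harmonic polynomial
  with a linear form becomes harmonic after subtracting a multiple of the squared radius times a
  derivative, and the squared radius is constant on the sphere. The obstacle in Perron's method is
  to show that the supremum of the competitors is harmonic. Its continuity up to the boundary is
  proved first, so that one harmonic replacement of the supremum itself, rather than a limit of
  replacements, settles the matter. This is where uniform constants enter: a translated competitor
  has to be compared at all boundary points at once, and the Lipschitz constant of the barriers
  depends on the diameter bound and the dimension alone. The same barrier, placed on a half ball,
  produces the gradient bound. A last difficulty is that \<open>'v\<close> carries only a norm and a
  finite spanning set, so the coordinate functionals have to be proved bounded before each
  coordinate can be solved separately.\<close>

definition has_laplacian ::
  "('a::euclidean_space \<Rightarrow> real) \<Rightarrow> ('a \<Rightarrow> real) \<Rightarrow> 'a set \<Rightarrow> bool" where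
  "has_laplacian f l D \<longleftrightarrow> (\<exists>f' f''. \<forall>x\<in>D. (f has_derivative f' x) (at x) \<and>
     (\<forall>b\<in>Basis. ((\<lambda>y. f' y b) has_derivative f'' b x) (at x)) \<and> l x = (\<Sum>b\<in>Basis. f'' b x b))"

lemma has_laplacianI:
  assumes "\<And>x. x \<in> D \<Longrightarrow> (f has_derivative f' x) (at x)"
    and "\<And>x b. x \<in> D \<Longrightarrow> b \<in> Basis \<Longrightarrow> ((\<lambda>y. f' y b) has_derivative f'' b x) (at x)"
    and "\<And>x. x \<in> D \<Longrightarrow> l x = (\<Sum>b\<in>Basis. f'' b x b)"
  shows "has_laplacian f l D"
  unfolding has_laplacian_def by (intro exI[of _ f'] exI[of _ f''] ballI conjI assms)

lemma has_laplacianE: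
  assumes "has_laplacian f l D"
  obtains f' f'' where "\<And>x. x \<in> D \<Longrightarrow> (f has_derivative f' x) (at x)"
    "\<And>x b. x \<in> D \<Longrightarrow> b \<in> Basis \<Longrightarrow> ((\<lambda>y. f' y b) has_derivative f'' b x) (at x)"
    "\<And>x. x \<in> D \<Longrightarrow> l x = (\<Sum>b\<in>Basis. f'' b x b)"
  using assms unfolding has_laplacian_def
  apply (elim exE)
  subgoal for f' f'' by (rule that[of f' f'']) simp_all
  done

lemma has_laplacian_subset: "has_laplacian f l D \<Longrightarrow> E \<subseteq> D \<Longrightarrow> has_laplacian f l E"
  by (erule has_laplacianE, rule has_laplacianI) auto

lemma has_laplacian_const: "has_laplacian (\<lambda>x. c) (\<lambda>x. 0) D"
  by (rule has_laplacianI[where f' = "\<lambda>x v. 0" and f'' = "\<lambda>b x v. 0"]) auto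

lemma has_laplacian_add:
  assumes "has_laplacian f l D" "has_laplacian g m D"
  shows "has_laplacian (\<lambda>x. f x + g x) (\<lambda>x. l x + m x) D"
proof -
  obtain f' f'' where f: "\<And>x. x \<in> D \<Longrightarrow> (f has_derivative f' x) (at x)"
    "\<And>x b. x \<in> D \<Longrightarrow> b \<in> Basis \<Longrightarrow> ((\<lambda>y. f' y b) has_derivative f'' b x) (at x)"
    "\<And>x. x \<in> D \<Longrightarrow> l x = (\<Sum>b\<in>Basis. f'' b x b)"
    using has_laplacianE[OF assms(1)] by blast
  obtain g' g'' where g: "\<And>x. x \<in> D \<Longrightarrow> (g has_derivative g' x) (at x)"
    "\<And>x b. x \<in> D \<Longrightarrow> b \<in> Basis \<Longrightarrow> ((\<lambda>y. g' y b) has_derivative g'' b x) (at x)"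
    "\<And>x. x \<in> D \<Longrightarrow> m x = (\<Sum>b\<in>Basis. g'' b x b)"
    using has_laplacianE[OF assms(2)] by blast
  show ?thesis
    by (rule has_laplacianI[where f' = "\<lambda>x v. f' x v + g' x v" and f'' = "\<lambda>b x v. f'' b x v + g'' b x v"])
      (auto intro!: derivative_intros f g simp: f g sum.distrib)
qed

lemma has_laplacian_cmult:
  assumes "has_laplacian f l D"
  shows "has_laplacian (\<lambda>x. c * f x) (\<lambda>x. c * l x) D"
proof -
  obtain f' f'' where f: "\<And>x. x \<in> D \<Longrightarrow> (f has_derivative f' x) (at x)"
    "\<And>x b. x \<in> D \<Longrightarrow> b \<in> Basis \<Longrightarrow> ((\<lambda>y. f' y b) has_derivative f'' b x) (at x)"
    "\<And>x. x \<in> D \<Longrightarrow> l x = (\<Sum>b\<in>Basis. f'' b x b)"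
    using has_laplacianE[OF assms(1)] by blast
  show ?thesis
    by (rule has_laplacianI[where f' = "\<lambda>x v. c * f' x v" and f'' = "\<lambda>b x v. c * f'' b x v"])
      (auto intro!: derivative_intros f simp: f sum_distrib_left)
qed

lemma has_laplacian_diff:
  assumes "has_laplacian f l D" "has_laplacian g m D"
  shows "has_laplacian (\<lambda>x. f x - g x) (\<lambda>x. l x - m x) D"
  using has_laplacian_add[OF assms(1) has_laplacian_cmult[OF assms(2), of "-1"]] by simp

lemma has_laplacian_translate:
  assumes "has_laplacian f l D"
  shows "has_laplacian (\<lambda>x. f (x + y)) (\<lambda>x. l (x + y)) {x. x + y \<in> D}"
proof -
  obtain f' f'' where f: "\<And>x. x \<in> D \<Longrightarrow> (f has_derivative f' x) (at x)"
    "\<And>x b. x \<in> D \<Longrightarrow> b \<in> Basis \<Longrightarrow> ((\<lambda>y. f' y b) has_derivative f'' b x) (at x)"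
    "\<And>x. x \<in> D \<Longrightarrow> l x = (\<Sum>b\<in>Basis. f'' b x b)"
    using has_laplacianE[OF assms(1)] by blast
  have shift: "((\<lambda>x. g (x + y)) has_derivative g') (at x)"
    if "(g has_derivative g') (at (x + y))" for g :: "'a \<Rightarrow> real" and g' x
    by (rule has_derivative_compose[where f = "\<lambda>x. x + y" and f' = "\<lambda>v. v", simplified])
       (auto intro!: derivative_eq_intros that)
  show ?thesis
    by (rule has_laplacianI[where f' = "\<lambda>x v. f' (x + y) v" and f'' = "\<lambda>b x v. f'' b (x + y) v"])
       (auto intro!: f shift)
qed

lemma has_laplacian_cong:
  assumes "open D" "\<And>x. x \<in> D \<Longrightarrow> f x = g x" "has_laplacian f l D"
  shows "has_laplacian g l D"
proof -
  obtain f' f'' where f: "\<And>x. x \<in> D \<Longrightarrow> (f has_derivative f' x) (at x)"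
    "\<And>x b. x \<in> D \<Longrightarrow> b \<in> Basis \<Longrightarrow> ((\<lambda>y. f' y b) has_derivative f'' b x) (at x)"
    "\<And>x. x \<in> D \<Longrightarrow> l x = (\<Sum>b\<in>Basis. f'' b x b)"
    using has_laplacianE[OF assms(3)] by blast
  show ?thesis
    by (rule has_laplacianI[where f' = f' and f'' = f''])
      (use f in \<open>auto intro: has_derivative_transform_within_open[OF _ \<open>open D\<close> _ assms(2)]\<close>)
qed

lemma has_laplacian_norm_sq:
  fixes a :: "'a::euclidean_space"
  shows "has_laplacian (\<lambda>x. (norm (x - a))\<^sup>2) (\<lambda>x. 2 * real DIM('a)) D"
  unfolding power2_norm_eq_inner
  by (rule has_laplacianI[where f' = "\<lambda>x v. 2 * ((x - a) \<bullet> v)" and f'' = "\<lambda>b x v. 2 * (v \<bullet> b)"])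
     (auto intro!: derivative_eq_intros simp: inner_commute algebra_simps)

text \<open>For a unit vector \<open>c\<close> this is harmonic, since the Hessian is twice the identity minus
  \<open>2 n c c\<^sup>T\<close>, and on the strip \<open>0 \<le> c \<bullet> (x - p) \<le> d\<close> it dominates the squared distance to \<open>p\<close>.\<close>

definition barrier :: "'a::euclidean_space \<Rightarrow> 'a \<Rightarrow> real \<Rightarrow> 'a \<Rightarrow> real" where
  "barrier p c d x = (norm (x - p))\<^sup>2 + real DIM('a) * ((c \<bullet> (x - p)) * (d - c \<bullet> (x - p)))"

lemma has_laplacian_barrier:
  fixes p c :: "'a::euclidean_space"
  assumes "norm c = 1"
  shows "has_laplacian (barrier p c d) (\<lambda>x. 0) D"
proof -
  let ?n = "real DIM('a)"
  have c: "(\<Sum>b\<in>Basis. (c \<bullet> b) * (c \<bullet> b)) = 1"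
    using assms by (metis euclidean_inner norm_eq_1)
  show ?thesis
    unfolding barrier_def[abs_def] power2_norm_eq_inner
    apply (rule has_laplacianI[where
        f' = "\<lambda>x v. 2 * ((x - p) \<bullet> v) + ?n * ((c \<bullet> v) * d - 2 * (c \<bullet> (x - p)) * (c \<bullet> v))"
        and f'' = "\<lambda>b x v. 2 * (v \<bullet> b) - 2 * ?n * ((c \<bullet> v) * (c \<bullet> b))"])
      apply (rule derivative_eq_intros refl)+
      apply (simp add: fun_eq_iff inner_commute algebra_simps)
      apply (rule derivative_eq_intros refl)+
      apply (simp add: fun_eq_iff inner_commute algebra_simps)
    apply (simp add: sum_subtractf c flip: sum_distrib_left)
    done
qed

lemma continuous_on_barrier [continuous_intros]: "continuous_on S (barrier p c d)"
  unfolding barrier_def[abs_def] by (intro continuous_intros)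

lemma barrier_self [simp]: "barrier p c d p = 0"
  by (simp add: barrier_def)

lemma barrier_ge:
  assumes "0 \<le> c \<bullet> (x - p)" "c \<bullet> (x - p) \<le> d"
  shows "(norm (x - p))\<^sup>2 \<le> barrier p c d x"
  unfolding barrier_def using assms by simp

text \<open>A positive derivative of \<open>g'\<close> at the critical point 0 makes
  \<open>g'\<close> positive just to the right of it, and by the mean value theorem \<open>g\<close>
  would rise above \<open>g 0\<close>.\<close>

lemma second_derivative_at_max:
  fixes g g' :: "real \<Rightarrow> real"
  assumes "e > 0" and g: "\<And>t. \<bar>t\<bar> < e \<Longrightarrow> (g has_real_derivative g' t) (at t)"
    and g': "(g' has_real_derivative c) (at 0)"
    and max: "\<And>t. \<bar>t\<bar> < e \<Longrightarrow> g t \<le> g 0"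
  shows "c \<le> 0"
proof (rule ccontr)
  assume "\<not> c \<le> 0"
  then have "c > 0" by simp
  have "g' 0 = 0"
    using DERIV_local_max[OF g[of 0] \<open>e > 0\<close>] max \<open>e > 0\<close> by auto
  obtain d where d: "d > 0" "\<And>h. h > 0 \<Longrightarrow> h < d \<Longrightarrow> g' 0 < g' (0 + h)"
    using DERIV_pos_inc_right[OF g' \<open>c > 0\<close>] by auto
  define t where "t = min d e / 2"
  have t: "0 < t" "t < d" "t < e" using d \<open>e > 0\<close> by (auto simp: t_def)
  obtain z where z: "0 < z" "z < t" "g t - g 0 = (t - 0) * g' z"
    using MVT2[of 0 t g g'] t g by auto
  have "g' z > 0" using d(2)[of z] z t \<open>g' 0 = 0\<close> by auto
  then have "g t - g 0 > 0" using z t by simp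
  then show False using max[of t] t by auto
qed

text \<open>Along each coordinate line through \<open>z\<close> the one-variable test applies, so
  every term of the trace is nonpositive.\<close>

lemma laplacian_at_max:
  assumes "open D" "has_laplacian f l D" "z \<in> D" and max: "\<And>x. x \<in> D \<Longrightarrow> f x \<le> f z"
  shows "l z \<le> 0"
proof -
  obtain f' f'' where f: "\<And>x. x \<in> D \<Longrightarrow> (f has_derivative f' x) (at x)"
    "\<And>x b. x \<in> D \<Longrightarrow> b \<in> Basis \<Longrightarrow> ((\<lambda>y. f' y b) has_derivative f'' b x) (at x)"
    "\<And>x. x \<in> D \<Longrightarrow> l x = (\<Sum>b\<in>Basis. f'' b x b)"
    using has_laplacianE[OF assms(2)] by blast
  obtain e where e: "e > 0" "ball z e \<subseteq> D" using assms by (meson open_contains_ball)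
  have line: "((\<lambda>t. g (z + t *\<^sub>R b)) has_real_derivative g' b) (at t)"
    if "(g has_derivative g') (at (z + t *\<^sub>R b))" for g :: "'a \<Rightarrow> real" and g' t b
  proof -
    have "((\<lambda>t. g (z + t *\<^sub>R b)) has_derivative (\<lambda>s. g' (s *\<^sub>R b))) (at t)"
      by (rule has_derivative_compose[where f = "\<lambda>t. z + t *\<^sub>R b" and g = g, OF _ that])
         (auto intro!: derivative_eq_intros)
    moreover have "(\<lambda>s. g' (s *\<^sub>R b)) = (\<lambda>s. g' b * s)"
      using has_derivative_linear[OF that] by (auto simp: linear_cmul)
    ultimately show ?thesis by (simp add: has_field_derivative_def)
  qed
  have "f'' b z b \<le> 0" if b: "b \<in> Basis" for b
  proof (rule second_derivative_at_max[OF e(1)])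
    have in_D: "z + t *\<^sub>R b \<in> D" if "\<bar>t\<bar> < e" for t
      using e(2) that b by (force simp: dist_norm)
    show "((\<lambda>t. f (z + t *\<^sub>R b)) has_real_derivative f' (z + t *\<^sub>R b) b) (at t)" if "\<bar>t\<bar> < e" for t
      by (rule line[OF f(1)[OF in_D[OF that]]])
    show "((\<lambda>t. f' (z + t *\<^sub>R b) b) has_real_derivative f'' b z b) (at 0)"
      by (rule line) (use f(2)[OF \<open>z \<in> D\<close> b] in simp)
    show "f (z + t *\<^sub>R b) \<le> f (z + 0 *\<^sub>R b)" if "\<bar>t\<bar> < e" for t
      using max[OF in_D[OF that]] by simp
  qed
  then show ?thesis unfolding f(3)[OF \<open>z \<in> D\<close>] by (rule sum_nonpos)
qed

text \<open>At an interior maximum the Laplacian is only known to be nonpositive, which does not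
  contradict \<open>l \<ge> 0\<close>. Adding a small multiple of the squared distance makes it
  strictly positive; centring that term at the offending point \<open>x\<close> leaves the value
  there unchanged.\<close>

lemma maximum_principle:
  fixes f :: "'a::euclidean_space \<Rightarrow> real"
  assumes "open D" "bounded D" "continuous_on (closure D) f" "has_laplacian f l D"
    and l: "\<And>x. x \<in> D \<Longrightarrow> l x \<ge> 0" and fr: "\<And>x. x \<in> frontier D \<Longrightarrow> f x \<le> 0" and "x \<in> closure D"
  shows "f x \<le> 0"
proof (rule ccontr)
  assume "\<not> f x \<le> 0"
  then have pos: "f x > 0" by simp
  have com: "compact (closure D)" using assms by (simp add: compact_closure)
  obtain R where R: "\<And>y. y \<in> closure D \<Longrightarrow> norm (y - x) \<le> R" "R > 0"
  proof -
    have "bounded ((\<lambda>y. y - x) ` closure D)"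
      using com by (intro compact_imp_bounded compact_continuous_image continuous_intros)
    then obtain R where "R > 0" "\<forall>y\<in>closure D. norm (y - x) \<le> R"
      unfolding bounded_pos by auto
    then show ?thesis using that by blast
  qed
  \<comment> \<open>On \<open>closure D\<close> the added term is then at most half of
    \<open>f x\<close>, so \<open>F\<close> stays below \<open>F x = f x\<close> on the
    frontier.\<close>
  define e where "e = f x / (2 * R\<^sup>2)"
  have e: "e > 0" "e * R\<^sup>2 < f x" using pos R(2) by (auto simp: e_def)
  define F where "F = (\<lambda>y. f y + e * (norm (y - x))\<^sup>2)"
  have cont: "continuous_on (closure D) F" unfolding F_def by (intro continuous_intros assms)
  have "closure D \<noteq> {}" using \<open>x \<in> closure D\<close> by auto
  then obtain z where zmax: "z \<in> closure D" "\<forall>y\<in>closure D. F y \<le> F z"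
    using continuous_attains_sup[OF com _ cont] by auto
  then have z: "z \<in> closure D" "\<And>y. y \<in> closure D \<Longrightarrow> F y \<le> F z" by auto
  have "z \<notin> frontier D"
  proof
    assume "z \<in> frontier D"
    then have "F z \<le> e * R\<^sup>2"
      unfolding F_def using fr[of z] R(1)[OF z(1)] e(1)
      by (smt (verit) mult_left_mono norm_ge_zero power_mono)
    moreover have "F z \<ge> f x" using z(2)[OF \<open>x \<in> closure D\<close>] by (simp add: F_def)
    ultimately show False using e by simp
  qed
  then have "z \<in> D" using z(1) \<open>open D\<close> by (simp add: frontier_def interior_open)
  have "has_laplacian F (\<lambda>y. l y + e * (2 * real DIM('a))) D"
    unfolding F_def by (intro has_laplacian_add assms has_laplacian_cmult has_laplacian_norm_sq)
  then have "l z + e * (2 * real DIM('a)) \<le> 0"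
    by (rule laplacian_at_max[OF \<open>open D\<close> _ \<open>z \<in> D\<close>]) (use z(2) closure_subset in blast)
  moreover have "e * (2 * real DIM('a)) > 0" using e by simp
  ultimately show False using l[OF \<open>z \<in> D\<close>] by simp
qed

lemma harmonic_le:
  fixes f g :: "'a::euclidean_space \<Rightarrow> real"
  assumes "open D" "bounded D" "continuous_on (closure D) f" "continuous_on (closure D) g"
    and "has_laplacian f (\<lambda>x. 0) D" "has_laplacian g (\<lambda>x. 0) D"
    and fr: "\<And>x. x \<in> frontier D \<Longrightarrow> f x \<le> g x" and "x \<in> closure D"
  shows "f x \<le> g x"
proof -
  have "f x - g x \<le> 0"
  proof (rule maximum_principle[OF assms(1,2)])
    show "has_laplacian (\<lambda>x. f x - g x) (\<lambda>x. 0 - 0) D"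
      using assms by (intro has_laplacian_diff)
  qed (use assms in \<open>auto intro!: continuous_intros\<close>)
  then show ?thesis by simp
qed

section \<open>Harmonic polynomials on spheres\<close>

definition dderiv :: "'a::real_normed_vector \<Rightarrow> ('a \<Rightarrow> real) \<Rightarrow> 'a \<Rightarrow> real" where
  "dderiv v f x = frechet_derivative f (at x) v"

definition laplacian :: "('a::euclidean_space \<Rightarrow> real) \<Rightarrow> 'a \<Rightarrow> real" where
  "laplacian f x = (\<Sum>b\<in>Basis. dderiv b (dderiv b f) x)"

text \<open>The derivative along the radial field about \<open>a\<close>. Polynomials homogeneous of
  degree \<open>k\<close> about \<open>a\<close> are its eigenfunctions with eigenvalue
  \<open>k\<close>.\<close>

definition euler :: "'a::euclidean_space \<Rightarrow> ('a \<Rightarrow> real) \<Rightarrow> 'a \<Rightarrow> real" where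
  "euler a f x = (\<Sum>b\<in>Basis. ((x - a) \<bullet> b) * dderiv b f x)"

lemma dderiv_eqI: "(f has_derivative f') (at x) \<Longrightarrow> dderiv v f x = f' v"
  unfolding dderiv_def by (metis frechet_derivative_at)

lemma poly_has_derivative:
  assumes "real_polynomial_function f"
  shows "(f has_derivative (\<lambda>v. dderiv v f x)) (at x)"
  unfolding dderiv_def using assms
  by (metis differentiable_at_real_polynomial_function frechet_derivative_works)

lemma dderiv_const [simp]: "dderiv v (\<lambda>x. c) = (\<lambda>x. 0)"
  by (auto intro!: ext dderiv_eqI)

lemma dderiv_linear: "bounded_linear f \<Longrightarrow> dderiv v f = (\<lambda>x. f v)"
  by (auto intro!: ext dderiv_eqI bounded_linear_imp_has_derivative)

lemma dderiv_add:
  assumes "real_polynomial_function f" "real_polynomial_function g"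
  shows "dderiv v (\<lambda>x. f x + g x) = (\<lambda>x. dderiv v f x + dderiv v g x)"
  by (rule ext, rule dderiv_eqI[THEN trans])
     (auto intro!: derivative_eq_intros poly_has_derivative assms)

lemma dderiv_diff:
  assumes "real_polynomial_function f" "real_polynomial_function g"
  shows "dderiv v (\<lambda>x. f x - g x) = (\<lambda>x. dderiv v f x - dderiv v g x)"
  by (rule ext, rule dderiv_eqI[THEN trans])
     (auto intro!: derivative_eq_intros poly_has_derivative assms)

lemma dderiv_mult:
  assumes "real_polynomial_function f" "real_polynomial_function g"
  shows "dderiv v (\<lambda>x. f x * g x) = (\<lambda>x. f x * dderiv v g x + dderiv v f x * g x)"
  by (rule ext, rule dderiv_eqI[THEN trans])
     (auto intro!: derivative_eq_intros poly_has_derivative assms)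

lemma dderiv_cmult:
  assumes "real_polynomial_function f"
  shows "dderiv v (\<lambda>x. c * f x) = (\<lambda>x. c * dderiv v f x)"
  by (rule ext, rule dderiv_eqI[THEN trans])
     (auto intro!: derivative_eq_intros poly_has_derivative assms)

lemma dderiv_sum:
  assumes "finite I" "\<And>i. i \<in> I \<Longrightarrow> real_polynomial_function (f i)"
  shows "dderiv v (\<lambda>x. \<Sum>i\<in>I. f i x) = (\<lambda>x. \<Sum>i\<in>I. dderiv v (f i) x)"
  by (rule ext, rule dderiv_eqI[THEN trans])
     (auto intro!: derivative_eq_intros poly_has_derivative assms)

lemma poly_dderiv:
  assumes "real_polynomial_function f"
  shows "real_polynomial_function (dderiv v f)"
  using assms
proof induction
  case (linear f)
  then show ?case by (auto simp: dderiv_linear)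
next
  case (const c)
  then show ?case by auto
next
  case (add f g)
  then show ?case by (auto simp: dderiv_add)
next
  case (mult f g)
  then show ?case by (auto simp: dderiv_mult)
qed

text \<open>The symmetry of second derivatives follows from the way polynomials are generated; the
  product rule is the only case with content.\<close>

lemma dderiv_commute:
  assumes "real_polynomial_function f"
  shows "dderiv v (dderiv w f) = dderiv w (dderiv v f)"
  using assms
proof induction
  case (linear f)
  then show ?case by (auto simp: dderiv_linear)
next
  case (const c)
  then show ?case by auto
next
  case (add f g)
  then show ?case by (auto simp: dderiv_add poly_dderiv)
next
  case (mult f g)
  then show ?case
    by (simp add: dderiv_add dderiv_mult poly_dderiv real_polynomial_function.intros(4))
      (auto simp: fun_eq_iff algebra_simps)
qed

lemma dderiv_linear_arg:
  assumes "real_polynomial_function f"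
  shows "linear (\<lambda>v. dderiv v f x)"
  using has_derivative_linear[OF poly_has_derivative[OF assms]] .

lemma dderiv_euclidean:
  assumes "real_polynomial_function f"
  shows "dderiv v f x = (\<Sum>b\<in>Basis. (v \<bullet> b) * dderiv b f x)"
proof -
  interpret linear "\<lambda>v. dderiv v f x" by (rule dderiv_linear_arg[OF assms])
  have "dderiv v f x = dderiv (\<Sum>b\<in>Basis. (v \<bullet> b) *\<^sub>R b) f x"
    by (simp add: euclidean_representation)
  then show ?thesis by (simp add: sum scaleR)
qed

lemma poly_has_laplacian:
  assumes "real_polynomial_function f"
  shows "has_laplacian f (laplacian f) D"
  by (rule has_laplacianI[where f' = "\<lambda>x v. dderiv v f x" and f'' = "\<lambda>b x v. dderiv v (dderiv b f) x"])
     (auto intro!: poly_has_derivative poly_dderiv assms simp: laplacian_def)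

lemma laplacian_const [simp]: "laplacian (\<lambda>x. c) = (\<lambda>x. 0)"
  by (simp add: laplacian_def[abs_def])

lemma laplacian_add:
  assumes "real_polynomial_function f" "real_polynomial_function g"
  shows "laplacian (\<lambda>x. f x + g x) x = laplacian f x + laplacian g x"
  by (simp add: laplacian_def dderiv_add poly_dderiv assms sum.distrib)

lemma laplacian_diff:
  assumes "real_polynomial_function f" "real_polynomial_function g"
  shows "laplacian (\<lambda>x. f x - g x) x = laplacian f x - laplacian g x"
  by (simp add: laplacian_def dderiv_diff poly_dderiv assms sum_subtractf)

lemma laplacian_cmult:
  assumes "real_polynomial_function f"
  shows "laplacian (\<lambda>x. c * f x) x = c * laplacian f x"
  by (simp add: laplacian_def dderiv_cmult poly_dderiv assms sum_distrib_left)

lemma laplacian_mult: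
  assumes "real_polynomial_function f" "real_polynomial_function g"
  shows "laplacian (\<lambda>x. f x * g x) x =
    f x * laplacian g x + 2 * (\<Sum>b\<in>Basis. dderiv b f x * dderiv b g x) + laplacian f x * g x"
  by (simp add: laplacian_def dderiv_add dderiv_mult poly_dderiv assms real_polynomial_function.intros(4)
      sum.distrib sum_distrib_left sum_distrib_right algebra_simps)

text \<open>Consequently derivatives of harmonic polynomials are harmonic, which lets first-order
  estimates be iterated to all orders.\<close>

lemma laplacian_dderiv:
  assumes "real_polynomial_function f"
  shows "laplacian (dderiv v f) = dderiv v (laplacian f)"
proof -
  have "dderiv b (dderiv b (dderiv v f)) = dderiv v (dderiv b (dderiv b f))" for b
    by (simp add: dderiv_commute[of _ _ v] poly_dderiv assms)
  then show ?thesis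
    unfolding laplacian_def[abs_def] by (simp add: dderiv_sum poly_dderiv assms)
qed

lemma poly_euler_coeff: "real_polynomial_function (\<lambda>x. (x - a) \<bullet> b)"
  unfolding inner_diff_left
  by (intro real_polynomial_function_diff real_polynomial_function.intros(2)
      real_polynomial_function.intros(1)[OF bounded_linear_inner_left])

lemma dderiv_euler_coeff: "dderiv v (\<lambda>x. (x - a) \<bullet> b) = (\<lambda>x. v \<bullet> b)"
  by (rule ext, rule dderiv_eqI[THEN trans]) (auto intro!: derivative_eq_intros)

lemma euler_diff:
  assumes "real_polynomial_function f" "real_polynomial_function g"
  shows "euler a (\<lambda>x. f x - g x) x = euler a f x - euler a g x"
  by (simp add: euler_def dderiv_diff assms sum_subtractf right_diff_distrib)

lemma euler_cmult:
  assumes "real_polynomial_function f"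
  shows "euler a (\<lambda>x. c * f x) x = c * euler a f x"
  by (simp add: euler_def dderiv_cmult assms sum_distrib_left mult.left_commute)

lemma euler_mult:
  assumes "real_polynomial_function f" "real_polynomial_function g"
  shows "euler a (\<lambda>x. f x * g x) x = f x * euler a g x + euler a f x * g x"
  by (simp add: euler_def dderiv_mult assms sum.distrib sum_distrib_left sum_distrib_right
      distrib_left distrib_right mult_ac)

text \<open>The commutator of \<open>dderiv v\<close> with the radial derivative is
  \<open>dderiv v\<close> itself: differentiation lowers the degree of homogeneity by one.\<close>

lemma euler_dderiv:
  assumes "real_polynomial_function f"
  shows "dderiv v (euler a f) x = dderiv v f x + euler a (dderiv v f) x"
proof -
  have "dderiv v (euler a f) x
      = (\<Sum>b\<in>Basis. dderiv v (\<lambda>x. ((x - a) \<bullet> b) * dderiv b f x) x)"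
    unfolding euler_def[abs_def]
    by (subst dderiv_sum) (auto intro!: poly_euler_coeff poly_dderiv assms real_polynomial_function.intros(4))
  also have "\<dots> = (\<Sum>b\<in>Basis. ((x - a) \<bullet> b) * dderiv v (dderiv b f) x + (v \<bullet> b) * dderiv b f x)"
    by (simp add: dderiv_mult poly_euler_coeff poly_dderiv assms dderiv_euler_coeff)
  also have "\<dots> = euler a (dderiv v f) x + dderiv v f x"
    by (simp add: euler_def sum.distrib dderiv_euclidean[OF assms, of v] dderiv_commute[OF assms, of v])
  finally show ?thesis by simp
qed

lemma poly_norm_sq: "real_polynomial_function (\<lambda>x::'a::euclidean_space. (norm (x - a))\<^sup>2)"
proof -
  have "(\<lambda>x. (norm (x - a))\<^sup>2) = (\<lambda>x. \<Sum>b\<in>Basis. ((x - a) \<bullet> b) * ((x - a) \<bullet> b))"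
    by (auto simp: fun_eq_iff power2_norm_eq_inner intro: euclidean_inner)
  then show ?thesis
    by (auto intro!: real_polynomial_function_sum real_polynomial_function.intros(4) poly_euler_coeff)
qed

lemma dderiv_norm_sq:
  "dderiv v (\<lambda>x::'a::euclidean_space. (norm (x - a))\<^sup>2) = (\<lambda>x. 2 * ((x - a) \<bullet> v))"
  unfolding power2_norm_eq_inner
  by (rule ext, rule dderiv_eqI[THEN trans])
     (auto intro!: derivative_eq_intros simp: inner_commute algebra_simps)

lemma laplacian_norm_sq:
  "laplacian (\<lambda>x::'a::euclidean_space. (norm (x - a))\<^sup>2) x = 2 * real DIM('a)"
  by (simp add: laplacian_def dderiv_norm_sq dderiv_cmult poly_euler_coeff dderiv_euler_coeff)

lemma euler_norm_sq:
  "euler a (\<lambda>x::'a::euclidean_space. (norm (x - a))\<^sup>2) x = 2 * (norm (x - a))\<^sup>2"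
proof -
  have "euler a (\<lambda>x. (norm (x - a))\<^sup>2) x = (\<Sum>b\<in>Basis. 2 * (((x - a) \<bullet> b) * ((x - a) \<bullet> b)))"
    by (simp add: euler_def dderiv_norm_sq mult.left_commute)
  also have "\<dots> = 2 * ((x - a) \<bullet> (x - a))"
    unfolding euclidean_inner[of "x - a" "x - a"] by (simp only: sum_distrib_left)
  finally show ?thesis by (simp only: power2_norm_eq_inner)
qed

text \<open>On the segment from \<open>a\<close> to \<open>x\<close>, the derivative at parameter
  \<open>z\<close> is \<open>euler a f\<close> there divided by \<open>z\<close>; the mean value
  theorem supplies such a \<open>z > 0\<close>.\<close>

lemma euler_zero_imp_const:
  assumes "real_polynomial_function f" "\<And>x. euler a f x = 0"
  shows "f x = f a"
proof -
  have "\<exists>z>0. z < 1 \<and> f (a + 1 *\<^sub>R (x - a)) - f (a + 0 *\<^sub>R (x - a)) = (1 - 0) * dderiv (x - a) f (a + z *\<^sub>R (x - a))"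
  proof (rule MVT2)
    fix t :: real
    show "((\<lambda>t. f (a + t *\<^sub>R (x - a))) has_real_derivative dderiv (x - a) f (a + t *\<^sub>R (x - a))) (at t)"
    proof -
      have "((\<lambda>t. f (a + t *\<^sub>R (x - a))) has_derivative (\<lambda>s. dderiv (s *\<^sub>R (x - a)) f (a + t *\<^sub>R (x - a)))) (at t)"
        by (rule has_derivative_compose[where f = "\<lambda>t. a + t *\<^sub>R (x - a)" and g = f, OF _ poly_has_derivative[OF assms(1)]])
           (auto intro!: derivative_eq_intros)
      then show ?thesis
        using linear_cmul[OF dderiv_linear_arg[OF assms(1)]]
        by (simp add: has_field_derivative_def mult_commute_abs)
    qed
  qed simp
  then obtain z where z: "0 < z" "f x - f a = dderiv (x - a) f (a + z *\<^sub>R (x - a))" by auto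
  have "z * dderiv (x - a) f (a + z *\<^sub>R (x - a)) = euler a f (a + z *\<^sub>R (x - a))"
    by (simp add: euler_def dderiv_euclidean[OF assms(1), of "x - a"] sum_distrib_left algebra_simps)
  then show ?thesis using z assms(2) by simp
qed

text \<open>Homogeneity about \<open>a\<close> is expressed by Euler's identity.\<close>

definition homogeneous_harmonic :: "'a::euclidean_space \<Rightarrow> nat \<Rightarrow> ('a \<Rightarrow> real) \<Rightarrow> bool" where
  "homogeneous_harmonic a k h \<longleftrightarrow> real_polynomial_function h \<and> (\<forall>x. laplacian h x = 0) \<and>
     (\<forall>x. euler a h x = real k * h x)"

text \<open>The degree of each summand is kept, because the correction after multiplication by a
  linear form depends on it.\<close>

inductive harmonic_sum :: "'a::euclidean_space \<Rightarrow> ('a \<Rightarrow> real) \<Rightarrow> bool" for a where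
  base: "homogeneous_harmonic a k h \<Longrightarrow> harmonic_sum a h"
| add: "harmonic_sum a f \<Longrightarrow> harmonic_sum a g \<Longrightarrow> harmonic_sum a (\<lambda>x. f x + g x)"

lemma harmonic_sum_harmonic:
  "harmonic_sum a h \<Longrightarrow> real_polynomial_function h \<and> (\<forall>x. laplacian h x = 0)"
  by (induction rule: harmonic_sum.induct)
     (auto simp: homogeneous_harmonic_def laplacian_add)

lemma homogeneous_harmonic_cmult:
  "homogeneous_harmonic a k h \<Longrightarrow> homogeneous_harmonic a k (\<lambda>x. c * h x)"
  by (auto simp: homogeneous_harmonic_def laplacian_cmult euler_cmult)

lemma harmonic_sum_cmult: "harmonic_sum a h \<Longrightarrow> harmonic_sum a (\<lambda>x. c * h x)"
proof (induction rule: harmonic_sum.induct)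
  case (base k h)
  then show ?case by (rule harmonic_sum.base[OF homogeneous_harmonic_cmult])
next
  case (add f g)
  then show ?case unfolding distrib_left by (intro harmonic_sum.add)
qed

lemma homogeneous_harmonic_dderiv:
  assumes "homogeneous_harmonic a (Suc k) h"
  shows "homogeneous_harmonic a k (dderiv v h)"
proof -
  have h: "real_polynomial_function h" and l: "laplacian h = (\<lambda>x. 0)"
    and e: "euler a h = (\<lambda>x. real (Suc k) * h x)"
    using assms by (auto simp: homogeneous_harmonic_def)
  have "euler a (dderiv v h) x = real k * dderiv v h x" for x
    using euler_dderiv[OF h, of v a x] unfolding e dderiv_cmult[OF h] by (simp add: algebra_simps)
  then show ?thesis
    by (simp add: homogeneous_harmonic_def poly_dderiv h laplacian_dderiv l)
qed

text \<open>Agreement is asked on the sphere alone, where \<open>(norm (x - a))\<^sup>2\<close> can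
  be traded for the constant \<open>r\<^sup>2\<close>; this makes the class closed under
  multiplication by polynomials.\<close>

definition sphere_harmonic :: "'a::euclidean_space \<Rightarrow> real \<Rightarrow> ('a \<Rightarrow> real) \<Rightarrow> bool" where
  "sphere_harmonic a r p \<longleftrightarrow> (\<exists>h. harmonic_sum a h \<and> (\<forall>x\<in>sphere a r. p x = h x))"

lemma sphere_harmonic_add:
  "sphere_harmonic a r p \<Longrightarrow> sphere_harmonic a r q \<Longrightarrow> sphere_harmonic a r (\<lambda>x. p x + q x)"
  unfolding sphere_harmonic_def
  by (elim exE conjE) (rule exI, rule conjI, erule (1) harmonic_sum.add, simp)

lemma sphere_harmonic_cmult:
  "sphere_harmonic a r p \<Longrightarrow> sphere_harmonic a r (\<lambda>x. c * p x)"
  unfolding sphere_harmonic_def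
  by (elim exE conjE) (rule exI, rule conjI, erule harmonic_sum_cmult[where c = c], simp)

text \<open>With \<open>g = \<partial>\<^sub>w h\<close>, where \<open>w\<close> represents \<open>L\<close>, one has \<open>\<Delta>(L h) = 2 g\<close>, and \<open>\<Delta>(\<bar>x\<bar>\<^sup>2 g)\<close> is a positive multiple
  of \<open>g\<close>. Hence \<open>L h\<close> minus a multiple of \<open>\<bar>x\<bar>\<^sup>2 g\<close> is harmonic, and \<open>\<bar>x\<bar>\<^sup>2\<close> is constant on the sphere.\<close>

lemma sphere_harmonic_mult_homogeneous:
  fixes a :: "'a::euclidean_space"
  assumes L: "bounded_linear L" and h: "homogeneous_harmonic a k h"
  shows "sphere_harmonic a r (\<lambda>x. L (x - a) * h x)"
proof -
  interpret L: bounded_linear L by fact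
  let ?L = "\<lambda>x. L (x - a)"
  define w where "w = (\<Sum>b\<in>Basis. L b *\<^sub>R b)"
  have Lp: "real_polynomial_function ?L"
    unfolding L.diff
    by (intro real_polynomial_function_diff real_polynomial_function.intros(1)[OF L] real_polynomial_function.intros(2))
  have dL: "dderiv v ?L = (\<lambda>x. L v)" for v
    by (rule ext, rule dderiv_eqI[THEN trans]) (auto intro!: derivative_eq_intros L.has_derivative)
  have eL: "euler a ?L x = L (x - a)" for x
  proof -
    have "L (x - a) = L (\<Sum>b\<in>Basis. ((x - a) \<bullet> b) *\<^sub>R b)" by (simp only: euclidean_representation)
    then show ?thesis by (simp add: euler_def dL L.sum L.scaleR)
  qed
  have lL: "laplacian ?L x = 0" for x by (simp add: laplacian_def dL)
  have hp: "real_polynomial_function h" and l: "laplacian h x = 0"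
    and e: "euler a h x = real k * h x" for x
    using h by (auto simp: homogeneous_harmonic_def)
  define g where "g = dderiv w h"
  have gp: "real_polynomial_function g" unfolding g_def by (rule poly_dderiv[OF hp])
  have lLh: "laplacian (\<lambda>x. ?L x * h x) x = 2 * g x" for x
  proof -
    have "g x = (\<Sum>b\<in>Basis. L b * dderiv b h x)"
      unfolding g_def dderiv_euclidean[OF hp, of w] by (intro sum.cong) (auto simp: w_def)
    then show ?thesis by (simp add: laplacian_mult Lp hp lL l dL)
  qed
  have eLh: "euler a (\<lambda>x. ?L x * h x) x = (1 + real k) * (?L x * h x)" for x
    by (simp add: euler_mult Lp hp eL e algebra_simps)
  show ?thesis
  proof (cases k)
    \<comment> \<open>Degree zero is separate, since \<open>g\<close> would need degree -1. Here
      \<open>h\<close> is constant, \<open>g\<close> vanishes and the product is already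
      harmonic.\<close>
    case 0
    then have "h = (\<lambda>x. h a)" using euler_zero_imp_const[OF hp] e by auto
    then have "g = (\<lambda>x. 0)" unfolding g_def by (metis dderiv_const)
    then have "homogeneous_harmonic a (Suc k) (\<lambda>x. ?L x * h x)"
      using lLh eLh Lp hp by (auto simp: homogeneous_harmonic_def)
    then show ?thesis unfolding sphere_harmonic_def by (blast intro: harmonic_sum.base)
  next
    case (Suc m)
    have hg: "homogeneous_harmonic a m g"
      unfolding g_def using homogeneous_harmonic_dderiv h Suc by blast
    then have lg: "laplacian g x = 0" and eg: "euler a g x = real m * g x" for x
      by (auto simp: homogeneous_harmonic_def)
    define N where "N = (\<lambda>x::'a. (norm (x - a))\<^sup>2)"
    have Np: "real_polynomial_function N" unfolding N_def by (rule poly_norm_sq)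
    have lN: "laplacian (\<lambda>x. N x * g x) x = (2 * real DIM('a) + 4 * real m) * g x" for x
    proof -
      have "(\<Sum>b\<in>Basis. dderiv b N x * dderiv b g x) = 2 * euler a g x"
        by (simp add: N_def dderiv_norm_sq euler_def sum_distrib_left algebra_simps)
      then have "laplacian (\<lambda>x. N x * g x) x = 4 * euler a g x + laplacian N x * g x"
        by (simp add: laplacian_mult Np gp lg)
      also have "laplacian N x = 2 * real DIM('a)" by (simp add: N_def laplacian_norm_sq)
      finally show ?thesis by (simp add: eg algebra_simps)
    qed
    have eN: "euler a (\<lambda>x. N x * g x) x = (1 + real k) * (N x * g x)" for x
    proof -
      have "euler a N x = 2 * N x" by (simp add: N_def euler_norm_sq)
      then show ?thesis by (simp add: euler_mult Np gp eg Suc algebra_simps)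
    qed
    have NG: "real_polynomial_function (\<lambda>x. N x * g x)"
      by (rule real_polynomial_function.intros(4)[OF Np gp])
    \<comment> \<open>\<open>lLh\<close> gives the Laplacian \<open>2 * g\<close> and
      \<open>lN\<close> gives \<open>(2 * n + 4 * m) * g\<close>, with \<open>n\<close> the
      dimension; \<open>c\<close> is the ratio of the two factors.\<close>
    define c where "c = 1 / (real DIM('a) + 2 * real m)"
    have c: "c * (2 * real DIM('a) + 4 * real m) = 2"
    proof -
      have "real DIM('a) + 2 * real m > 0" by (simp add: add_pos_nonneg)
      then show ?thesis by (simp add: c_def field_simps)
    qed
    define h1 where "h1 = (\<lambda>x. ?L x * h x - c * (N x * g x))"
    have "laplacian h1 x = 0" for x
    proof -
      have "laplacian h1 x = 2 * g x - c * ((2 * real DIM('a) + 4 * real m) * g x)"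
        unfolding h1_def
        by (subst laplacian_diff) (auto simp: laplacian_cmult NG lLh lN intro!: Lp hp NG)
      also have "\<dots> = (2 - c * (2 * real DIM('a) + 4 * real m)) * g x" by (simp add: algebra_simps)
      finally show ?thesis by (simp add: c)
    qed
    moreover have "euler a h1 x = real (Suc k) * h1 x" for x
    proof -
      have "euler a h1 x = (1 + real k) * (?L x * h x) - c * ((1 + real k) * (N x * g x))"
        unfolding h1_def
        by (subst euler_diff) (auto simp: euler_cmult NG eLh eN intro!: Lp hp NG)
      then show ?thesis by (simp add: h1_def algebra_simps)
    qed
    moreover have "real_polynomial_function h1"
      unfolding h1_def
      by (intro real_polynomial_function_diff real_polynomial_function.intros(4)[OF Lp hp]
          real_polynomial_function.intros(4)[OF real_polynomial_function.intros(2) NG])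
    ultimately have "homogeneous_harmonic a (Suc k) h1" by (simp add: homogeneous_harmonic_def)
    \<comment> \<open>Replacing \<open>N\<close> by \<open>r\<^sup>2\<close> splits the product on
      the sphere into a part of degree \<open>Suc k\<close> and a part of degree
      \<open>m\<close>.\<close>
    then have "harmonic_sum a (\<lambda>x. h1 x + c * r\<^sup>2 * g x)"
      by (rule harmonic_sum.add[OF harmonic_sum.base harmonic_sum_cmult[OF harmonic_sum.base[OF hg]]])
    moreover have "?L x * h x = h1 x + c * r\<^sup>2 * g x" if "x \<in> sphere a r" for x
      using that by (simp add: h1_def N_def dist_norm norm_minus_commute)
    ultimately show ?thesis unfolding sphere_harmonic_def by blast
  qed
qed

text \<open>The centred case is applied summand by summand; the remaining factor
  \<open>L x - L (x - a) = L a\<close> is a scalar.\<close>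

lemma sphere_harmonic_mult_linear:
  assumes L: "bounded_linear L" and p: "sphere_harmonic a r p"
  shows "sphere_harmonic a r (\<lambda>x. L x * p x)"
proof -
  obtain h where h: "harmonic_sum a h" "\<And>x. x \<in> sphere a r \<Longrightarrow> p x = h x"
    using p unfolding sphere_harmonic_def by blast
  from h(1) have "sphere_harmonic a r (\<lambda>x. L (x - a) * h x)"
  proof induction
    case (base k h)
    then show ?case by (rule sphere_harmonic_mult_homogeneous[OF L])
  next
    case (add f g)
    then show ?case unfolding distrib_left by (intro sphere_harmonic_add)
  qed
  moreover have "sphere_harmonic a r (\<lambda>x. L a * h x)"
    using harmonic_sum_cmult[OF h(1)] unfolding sphere_harmonic_def by blast
  ultimately have "sphere_harmonic a r (\<lambda>x. L (x - a) * h x + L a * h x)"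
    by (rule sphere_harmonic_add)
  moreover have "L (x - a) * h x + L a * h x = L x * h x" for x
    using bounded_linear.linear[OF L] by (simp add: linear_diff algebra_simps)
  ultimately have "sphere_harmonic a r (\<lambda>x. L x * h x)" by simp
  then show ?thesis unfolding sphere_harmonic_def using h(2) by auto
qed

text \<open>\<open>q\<close> varies in the induction so that a product \<open>f * g\<close> can act
  as \<open>g\<close> followed by \<open>f\<close>. Taking \<open>q\<close> to be the constant 1
  then handles \<open>p\<close> itself.\<close>

lemma sphere_harmonic_poly_mult:
  assumes "real_polynomial_function p" "sphere_harmonic a r q"
  shows "sphere_harmonic a r (\<lambda>x. p x * q x)"
  using assms
proof (induction arbitrary: q)
  case (linear f)
  then show ?case by (rule sphere_harmonic_mult_linear)
next
  case (const c)
  then show ?case by (rule sphere_harmonic_cmult)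
next
  case (add f g)
  then show ?case unfolding distrib_right
    by (intro sphere_harmonic_add add.IH(1)[OF add.prems] add.IH(2)[OF add.prems])
next
  case (mult f g)
  then show ?case
    unfolding mult.assoc by (intro mult.IH(1)[OF mult.IH(2)[OF mult.prems]])
qed

lemma poly_dirichlet_sphere:
  fixes a :: "'a::euclidean_space"
  assumes "real_polynomial_function p"
  obtains h where "real_polynomial_function h" "\<And>x. laplacian h x = 0"
    "\<And>x. x \<in> sphere a r \<Longrightarrow> h x = p x"
proof -
  have "homogeneous_harmonic a 0 (\<lambda>x. 1)"
    by (auto simp: homogeneous_harmonic_def euler_def)
  then have "sphere_harmonic a r (\<lambda>x. 1)"
    unfolding sphere_harmonic_def by (blast intro: harmonic_sum.base)
  from sphere_harmonic_poly_mult[OF assms this] obtain h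
    where "harmonic_sum a h" "\<forall>x\<in>sphere a r. p x = h x"
    unfolding sphere_harmonic_def by auto
  then show ?thesis using harmonic_sum_harmonic[of a h] that by auto
qed

section \<open>Gradient bounds and limits of harmonic polynomials\<close>

text \<open>The linear part \<open>R\<close> of the reflection sends \<open>e\<close> to
  \<open>- e\<close> and fixes the other basis vectors, so every pure second derivative along the
  basis keeps its value. This is why \<open>e\<close> is taken from \<open>Basis\<close>.\<close>

lemma has_laplacian_reflect:
  fixes h :: "'a::euclidean_space \<Rightarrow> real"
  assumes h: "real_polynomial_function h" "\<And>x. laplacian h x = 0" and e: "e \<in> Basis"
  shows "has_laplacian (\<lambda>y. h (y - (2 * ((y - x) \<bullet> e)) *\<^sub>R e)) (\<lambda>y. 0) D"
proof -
  define R where "R = (\<lambda>v::'a. v - (2 * (v \<bullet> e)) *\<^sub>R e)"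
  define S where "S = (\<lambda>y. y - (2 * ((y - x) \<bullet> e)) *\<^sub>R e)"
  have S: "(S has_derivative R) (at y)" for y
    unfolding S_def R_def by (auto intro!: derivative_eq_intros simp: fun_eq_iff algebra_simps)
  have comp: "((\<lambda>y. g (S y)) has_derivative (\<lambda>v. dderiv (R v) g (S y))) (at y)"
    if "real_polynomial_function g" for g y
    by (rule has_derivative_compose[OF S poly_has_derivative[OF that]])
  have "has_laplacian (\<lambda>y. h (S y)) (\<lambda>y. 0) D"
  proof (rule has_laplacianI[where f' = "\<lambda>y v. dderiv (R v) h (S y)"
        and f'' = "\<lambda>b y v. dderiv (R v) (dderiv (R b) h) (S y)"])
    fix y
    have "dderiv (R b) (dderiv (R b) h) (S y) = dderiv b (dderiv b h) (S y)" if b: "b \<in> Basis" for b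
    proof (cases "b = e")
      case True
      then have R: "R b = - b" using e by (simp add: R_def algebra_simps flip: scaleR_2)
      have neg: "dderiv (- b) g z = - dderiv b g z" if "real_polynomial_function g" for g z
        using linear_neg[OF dderiv_linear_arg[OF that]] .
      have "dderiv (- b) h = (\<lambda>z. (-1) * dderiv b h z)" using neg[OF h(1)] by auto
      then show ?thesis
        using dderiv_cmult[OF poly_dderiv[OF h(1)], of _ "-1"] unfolding R by (simp add: dderiv_cmult poly_dderiv h neg)
    next
      case False
      then show ?thesis using b e by (simp add: R_def inner_Basis)
    qed
    then show "0 = (\<Sum>b\<in>Basis. dderiv (R b) (dderiv (R b) h) (S y))"
      using h(2)[of "S y"] by (simp add: laplacian_def)
  qed (intro comp poly_dderiv h)+
  then show ?thesis by (simp add: S_def)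
qed

text \<open>On the half ball, the odd part of \<open>h\<close> under reflection in the hyperplane through \<open>x\<close> orthogonal to
  \<open>e\<close> is dominated by a multiple of the barrier at \<open>x\<close>; both vanish at \<open>x\<close>, so their derivatives compare.\<close>

lemma gradient_bound_upper:
  fixes h :: "'a::euclidean_space \<Rightarrow> real"
  assumes h: "real_polynomial_function h" "\<And>x. laplacian h x = 0" and e: "e \<in> Basis" and d: "d > 0"
    and M: "\<And>y. y \<in> cball x d \<Longrightarrow> \<bar>h y\<bar> \<le> M"
  shows "dderiv e h x \<le> real DIM('a) * M / d"
proof (rule ccontr)
  let ?n = "real DIM('a)"
  assume *: "\<not> dderiv e h x \<le> ?n * M / d"
  have M0: "M \<ge> 0" using M[of x] d by auto
  have e1: "norm e = 1" "e \<bullet> e = 1" using e by simp_all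
  define S where "S = (\<lambda>y. y - (2 * ((y - x) \<bullet> e)) *\<^sub>R e)"
  define \<phi> where "\<phi> = (\<lambda>y. (1/2) * (h y - h (S y)))"
  \<comment> \<open>The factor makes \<open>\<psi>\<close> at least \<open>M\<close> on the
    spherical part of the boundary of the half ball, by \<open>barrier_ge\<close> with strip width
    \<open>d\<close>.\<close>
  define \<psi> where "\<psi> = (\<lambda>y. (M / d\<^sup>2) * barrier x e d y)"
  define D where "D = ball x d \<inter> {y. e \<bullet> x < e \<bullet> y}"
  have D: "open D" "bounded D"
    unfolding D_def by (auto intro: open_Int open_halfspace_gt bounded_Int)
  have hc: "continuous_on T h" for T
    using h(1) by (simp add: continuous_on_polymonial_function real_polynomial_function_eq)
  have \<phi>: "continuous_on T \<phi>" "has_laplacian \<phi> (\<lambda>y. 0) T" for T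
  proof -
    show "continuous_on T \<phi>"
      unfolding \<phi>_def S_def
      by (intro continuous_intros continuous_on_compose2[OF hc[of UNIV]]) auto
    have "has_laplacian h (\<lambda>y. 0) T"
      using poly_has_laplacian[OF h(1)] h(2) by (simp add: laplacian_def[abs_def])
    then have "has_laplacian \<phi> (\<lambda>y. (1/2) * (0 - 0)) T"
      unfolding \<phi>_def S_def
      by (intro has_laplacian_cmult has_laplacian_diff has_laplacian_reflect h e)
    then show "has_laplacian \<phi> (\<lambda>y. 0) T" by simp
  qed
  have \<psi>: "continuous_on T \<psi>" "has_laplacian \<psi> (\<lambda>y. 0) T" for T
    unfolding \<psi>_def using has_laplacian_cmult[OF has_laplacian_barrier[OF e1(1), of x d T], of "M / d\<^sup>2"]
    by (intro continuous_intros, simp only: mult_zero_right)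
  have cl: "closure D \<subseteq> cball x d \<inter> {y. e \<bullet> x \<le> e \<bullet> y}"
    by (rule closure_minimal) (auto simp: D_def intro: closed_Int closed_halfspace_ge)
  have fr: "\<phi> y \<le> \<psi> y" if y: "y \<in> frontier D" for y
  proof -
    have yc: "norm (y - x) \<le> d" "e \<bullet> x \<le> e \<bullet> y"
      using y cl by (auto simp: frontier_def dist_norm norm_minus_commute)
    have yD: "y \<notin> D" using y D(1) by (auto simp: frontier_def interior_open)
    have "e \<bullet> (y - x) \<le> d"
      using Cauchy_Schwarz_ineq2[of e "y - x"] e1 yc by simp
    then have bar: "(norm (y - x))\<^sup>2 \<le> barrier x e d y"
      using yc by (intro barrier_ge) (auto simp: inner_diff_right)
    \<comment> \<open>A boundary point of the half ball lies on the flat face, where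
      \<open>\<phi>\<close> is zero, or on the sphere, where the bound \<open>M\<close>
      applies.\<close>
    consider "e \<bullet> x = e \<bullet> y" | "norm (y - x) = d"
      using yc yD by (force simp: D_def dist_norm norm_minus_commute)
    then show ?thesis
    proof cases
      case 1
      then have "S y = y" by (simp add: S_def inner_diff_right inner_commute)
      then show ?thesis using M0 bar by (simp add: \<phi>_def \<psi>_def order_trans[OF zero_le_power2])
    next
      case 2
      have "norm (S y - x) = norm (y - x)"
      proof -
        have "(S y - x) \<bullet> (S y - x) = (y - x) \<bullet> (y - x)"
          using e1 by (simp add: S_def inner_commute algebra_simps)
        then show ?thesis by (simp add: norm_eq)
      qed
      then have "\<bar>h y\<bar> \<le> M" "\<bar>h (S y)\<bar> \<le> M"
        using 2 by (auto intro!: M simp: dist_norm norm_minus_commute)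
      then have "\<phi> y \<le> M" by (simp add: \<phi>_def)
      also have "M = (M / d\<^sup>2) * (norm (y - x))\<^sup>2" using 2 d by simp
      also have "\<dots> \<le> \<psi> y" unfolding \<psi>_def using bar M0 by (intro mult_left_mono) auto
      finally show ?thesis .
    qed
  qed
  have le: "\<phi> (x + t *\<^sub>R e) \<le> \<psi> (x + t *\<^sub>R e)" if "0 < t" "t < d" for t
  proof (rule harmonic_le[OF D \<phi>(1) \<psi>(1) \<phi>(2) \<psi>(2) fr])
    have "x + t *\<^sub>R e \<in> D" using that e1 by (simp add: D_def dist_norm algebra_simps)
    then show "x + t *\<^sub>R e \<in> closure D" using closure_subset by blast
  qed
  \<comment> \<open>\<open>F\<close> vanishes at 0 and is nonnegative between 0 and
    \<open>d\<close>, while its slope at 0 is \<open>n * M / d - dderiv e h x\<close>, with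
    \<open>n\<close> the dimension. A derivative of \<open>h\<close> above the bound would make
    \<open>F\<close> negative just after 0.\<close>
  define F where "F = (\<lambda>t. \<psi> (x + t *\<^sub>R e) - \<phi> (x + t *\<^sub>R e))"
  have F: "F = (\<lambda>t. (M / d\<^sup>2) * (t\<^sup>2 + ?n * (t * (d - t)))
      - (1/2) * (h (x + t *\<^sub>R e) - h (x + (-t) *\<^sub>R e)))"
  proof -
    have "S (x + t *\<^sub>R e) = x + (-t) *\<^sub>R e" for t
    proof -
      have "S (x + t *\<^sub>R e) = x + (t *\<^sub>R e - (2 * t) *\<^sub>R e)" by (simp add: S_def e1(2))
      also have "t *\<^sub>R e - (2 * t) *\<^sub>R e = (-t) *\<^sub>R e"
        by (simp flip: scaleR_left_diff_distrib)
      finally show ?thesis .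
    qed
    then show ?thesis by (simp add: F_def \<psi>_def \<phi>_def barrier_def e1)
  qed
  have line: "((\<lambda>t. h (x + (c * t) *\<^sub>R e)) has_real_derivative c * dderiv e h x) (at 0)" for c
  proof -
    have "((\<lambda>t. h (x + (c * t) *\<^sub>R e)) has_derivative (\<lambda>s. dderiv ((c * s) *\<^sub>R e) h x)) (at 0)"
      by (rule has_derivative_compose[where f = "\<lambda>t. x + (c * t) *\<^sub>R e" and g = h])
         (auto intro!: derivative_eq_intros poly_has_derivative h)
    then show ?thesis
      using linear_cmul[OF dderiv_linear_arg[OF h(1)]]
      by (simp add: has_field_derivative_def mult_commute_abs mult.assoc mult.left_commute)
  qed
  have "(F has_real_derivative (M / d\<^sup>2) * (?n * d) - (1/2) * (dderiv e h x - (- dderiv e h x))) (at 0)"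
  proof -
    have l1: "((\<lambda>t. h (x + t *\<^sub>R e)) has_real_derivative dderiv e h x) (at 0)"
      using line[of 1] by simp
    have l2: "((\<lambda>t. h (x + (-t) *\<^sub>R e)) has_real_derivative - dderiv e h x) (at 0)"
      using line[of "-1"] by simp
    have "((\<lambda>t. t\<^sup>2 + ?n * (t * (d - t))) has_real_derivative ?n * d) (at 0)"
      by (auto intro!: derivative_eq_intros)
    then have "((\<lambda>t. (M / d\<^sup>2) * (t\<^sup>2 + ?n * (t * (d - t)))) has_real_derivative (M / d\<^sup>2) * (?n * d)) (at 0)"
      by (rule DERIV_cmult)
    from DERIV_diff[OF this DERIV_cmult[OF DERIV_diff[OF l1 l2], of "1/2"]]
    show ?thesis unfolding F .
  qed
  moreover have "(M / d\<^sup>2) * (?n * d) - (1/2) * (dderiv e h x - (- dderiv e h x)) < 0"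
  proof -
    have "(M / d\<^sup>2) * (?n * d) = ?n * M / d" using d by (simp add: power2_eq_square)
    then show ?thesis using * by simp
  qed
  ultimately obtain s where s: "s > 0" "\<And>t. t > 0 \<Longrightarrow> t < s \<Longrightarrow> F (0 + t) < F 0"
    using DERIV_neg_dec_right by blast
  have "F 0 = 0" by (simp add: F)
  define t where "t = min s d / 2"
  have "0 < t" "t < s" "t < d" using s(1) d by (auto simp: t_def)
  then show False using s(2)[of t] le[of t] \<open>F 0 = 0\<close> by (simp add: F_def)
qed

text \<open>Applying the one-sided bound to \<open>h\<close> and to \<open>- h\<close> controls each
  partial derivative by \<open>n * M / d\<close>, with \<open>n\<close> the dimension; summing over
  the basis brings in the second factor \<open>n\<close>.\<close>

lemma gradient_bound:
  fixes h :: "'a::euclidean_space \<Rightarrow> real"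
  assumes h: "real_polynomial_function h" "\<And>x. laplacian h x = 0" and d: "d > 0"
    and M: "\<And>y. y \<in> cball x d \<Longrightarrow> \<bar>h y\<bar> \<le> M"
  shows "\<bar>dderiv v h x\<bar> \<le> (real DIM('a))\<^sup>2 * M / d * norm v"
proof -
  let ?C = "real DIM('a) * M / d"
  have "\<bar>dderiv b h x\<bar> \<le> ?C" if b: "b \<in> Basis" for b
  proof -
    have "dderiv b (\<lambda>x. (-1) * h x) x \<le> ?C"
      by (rule gradient_bound_upper[OF _ _ b d])
         (use M in \<open>auto simp: laplacian_cmult[OF h(1), of "-1", simplified] h\<close>)
    then have "- dderiv b h x \<le> ?C" unfolding dderiv_cmult[OF h(1)] by simp
    moreover have "dderiv b h x \<le> ?C" by (rule gradient_bound_upper[OF h b d M])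
    ultimately show ?thesis by simp
  qed
  then have "\<bar>(v \<bullet> b) * dderiv b h x\<bar> \<le> norm v * ?C" if "b \<in> Basis" for b
    unfolding abs_mult using that by (intro mult_mono) (auto simp: Basis_le_norm)
  then have "\<bar>dderiv v h x\<bar> \<le> (\<Sum>b\<in>(Basis::'a set). norm v * ?C)"
    unfolding dderiv_euclidean[OF h(1), of v]
    by (intro order_trans[OF sum_abs] sum_mono)
  then show ?thesis by (simp add: power2_eq_square mult_ac)
qed

section \<open>Closure properties of \<open>Ck_on\<close>, and limits of harmonic
  polynomials\<close>

lemma frechet_derivative_cong_open:
  assumes "open S" "x \<in> S" "\<And>y. y \<in> S \<Longrightarrow> f y = g y" "f differentiable (at x)"
  shows "g differentiable (at x)" "frechet_derivative g (at x) = frechet_derivative f (at x)"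
proof -
  have "(f has_derivative frechet_derivative f (at x)) (at x)"
    using assms(4) frechet_derivative_works by blast
  then have g: "(g has_derivative frechet_derivative f (at x)) (at x)"
    by (rule has_derivative_transform_within_open[OF _ assms(1,2,3)])
  then show "g differentiable (at x)" unfolding differentiable_def by blast
  show "frechet_derivative g (at x) = frechet_derivative f (at x)"
    using frechet_derivative_at[OF g] by simp
qed

lemma Ck_on_cong:
  assumes "open S" "\<And>x. x \<in> S \<Longrightarrow> f x = g x" "Ck_on k S f"
  shows "Ck_on k S g"
  using assms(2,3)
proof (induction k arbitrary: f g)
  case 0
  then show ?case by (simp cong: continuous_on_cong)
next
  case (Suc k)
  note fr = frechet_derivative_cong_open[OF assms(1) _ Suc.prems(1)]
  have d: "\<And>x. x \<in> S \<Longrightarrow> f differentiable (at x)" using Suc.prems(2) by simp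
  have "Ck_on k S (\<lambda>x. frechet_derivative g (at x) v)" for v
  proof (rule Suc.IH)
    show "Ck_on k S (\<lambda>x. frechet_derivative f (at x) v)" using Suc.prems(2) by simp
    show "frechet_derivative f (at x) v = frechet_derivative g (at x) v" if "x \<in> S" for x
      using fr(2)[OF that _ d[OF that]] by simp
  qed
  then show ?case using fr(1)[OF _ _ d] by simp
qed

lemma Ck_on_local:
  assumes "\<And>x. x \<in> S \<Longrightarrow> \<exists>T. open T \<and> x \<in> T \<and> Ck_on k T f"
  shows "Ck_on k S f"
  using assms
proof (induction k arbitrary: f)
  case 0
  have "isCont f x" if "x \<in> S" for x
    using 0[OF that] by (auto simp: continuous_on_eq_continuous_at)
  then show ?case by (simp add: continuous_at_imp_continuous_on)
next
  case (Suc k)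
  have "f differentiable (at x)" if "x \<in> S" for x
    using Suc.prems[OF that] by auto
  moreover have "Ck_on k S (\<lambda>x. frechet_derivative f (at x) v)" for v
    by (rule Suc.IH) (use Suc.prems in fastforce)
  ultimately show ?case by simp
qed

lemma Ck_on_add:
  assumes "open S" "Ck_on k S f" "Ck_on k S g"
  shows "Ck_on k S (\<lambda>x. f x + g x)"
  using assms(2,3)
proof (induction k arbitrary: f g)
  case 0
  then show ?case by (auto intro: continuous_intros)
next
  case (Suc k)
  have d: "f differentiable (at x)" "g differentiable (at x)" if "x \<in> S" for x
    using Suc.prems that by auto
  have fr: "frechet_derivative f (at x) v + frechet_derivative g (at x) v
      = frechet_derivative (\<lambda>x. f x + g x) (at x) v" if "x \<in> S" for x v
  proof -
    have "((\<lambda>x. f x + g x) has_derivative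
        (\<lambda>v. frechet_derivative f (at x) v + frechet_derivative g (at x) v)) (at x)"
      using d[OF that] by (intro has_derivative_add) (simp_all add: frechet_derivative_works)
    from fun_cong[OF frechet_derivative_at[OF this], of v] show ?thesis .
  qed
  have "Ck_on k S (\<lambda>x. frechet_derivative (\<lambda>x. f x + g x) (at x) v)" for v
    by (rule Ck_on_cong[OF assms(1) fr Suc.IH]) (use Suc.prems in auto)
  then show ?case using d by simp
qed

lemma frechet_derivative_bounded_linear:
  assumes "bounded_linear L" "f differentiable (at x)"
  shows "(\<lambda>x. L (f x)) differentiable (at x)"
    "frechet_derivative (\<lambda>x. L (f x)) (at x) v = L (frechet_derivative f (at x) v)"
proof -
  have L: "((\<lambda>x. L (f x)) has_derivative (\<lambda>v. L (frechet_derivative f (at x) v))) (at x)"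
    using assms(2) by (intro bounded_linear.has_derivative[OF assms(1)])
      (simp add: frechet_derivative_works)
  then show "(\<lambda>x. L (f x)) differentiable (at x)" unfolding differentiable_def by blast
  show "frechet_derivative (\<lambda>x. L (f x)) (at x) v = L (frechet_derivative f (at x) v)"
    using fun_cong[OF frechet_derivative_at[OF L], of v] by simp
qed

lemma Ck_on_bounded_linear:
  assumes "open S" "bounded_linear L" "Ck_on k S f"
  shows "Ck_on k S (\<lambda>x. L (f x))"
  using assms(3)
proof (induction k arbitrary: f)
  case 0
  then show ?case by (auto intro: bounded_linear.continuous_on[OF assms(2)])
next
  case (Suc k)
  have d: "f differentiable (at x)" if "x \<in> S" for x
    using Suc.prems that by auto
  have "Ck_on k S (\<lambda>x. frechet_derivative (\<lambda>x. L (f x)) (at x) v)" for v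
    by (rule Ck_on_cong[OF assms(1) _ Suc.IH[of "\<lambda>x. frechet_derivative f (at x) v"]])
       (use Suc.prems frechet_derivative_bounded_linear[OF assms(2) d] in auto)
  then show ?case using frechet_derivative_bounded_linear[OF assms(2) d] by simp
qed

text \<open>One closed ball about each point is enough: halving its radius leaves room for the
  gradient bound, so the property passes to derivatives.\<close>

definition locally_uniform_limit ::
  "'a::metric_space set \<Rightarrow> (nat \<Rightarrow> 'a \<Rightarrow> real) \<Rightarrow> ('a \<Rightarrow> real) \<Rightarrow> bool" where
  "locally_uniform_limit D f F \<longleftrightarrow>
     (\<forall>x\<in>D. \<exists>r>0. cball x r \<subseteq> D \<and> uniform_limit (cball x r) f F sequentially)"

text \<open>The gradient bound, applied to differences \<open>f m - f n\<close> on balls of half the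
  radius, turns uniformly Cauchy values into uniformly Cauchy derivatives. \<open>G\<close> is a
  \<open>lim\<close> and hence total; on \<open>D\<close> the limit exists.\<close>

lemma harmonic_limit_derivative:
  fixes f :: "nat \<Rightarrow> 'a::euclidean_space \<Rightarrow> real"
  assumes p: "\<And>n. real_polynomial_function (f n)" and l: "\<And>n x. laplacian (f n) x = 0"
    and lim: "locally_uniform_limit D f F"
  defines "G \<equiv> \<lambda>v x. lim (\<lambda>n. dderiv v (f n) x)"
  shows "x \<in> D \<Longrightarrow> (F has_derivative (\<lambda>v. G v x)) (at x)"
    and "locally_uniform_limit D (\<lambda>n. dderiv v (f n)) (G v)"
proof -
  \<comment> \<open>The error is measured against \<open>norm v\<close> with \<open>N\<close>
    independent of \<open>v\<close>, as termwise differentiation requires.\<close>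
  have core: "\<exists>s>0. cball x s \<subseteq> D \<and> (\<forall>e>0. \<exists>N. \<forall>n\<ge>N. \<forall>y\<in>cball x s. \<forall>v.
      \<bar>dderiv v (f n) y - G v y\<bar> \<le> e * norm v) \<and> (\<forall>y\<in>cball x s. (\<lambda>n. f n y) \<longlonglongrightarrow> F y)"
    if x: "x \<in> D" for x
  proof -
    obtain r where r: "r > 0" "cball x r \<subseteq> D" and ul: "uniform_limit (cball x r) f F sequentially"
      using lim x unfolding locally_uniform_limit_def by blast
    have sub: "cball y (r/2) \<subseteq> cball x r" if "y \<in> cball x (r/2)" for y
    proof
      fix z assume "z \<in> cball y (r/2)"
      then show "z \<in> cball x r" using that dist_triangle[of x z y] by auto
    qed
    \<comment> \<open>The factor of the gradient bound on balls of radius \<open>r/2\<close>: a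
      difference bounded by \<open>e / C\<close> has slope at most \<open>e\<close>.\<close>
    define C where "C = (real DIM('a))\<^sup>2 / (r/2)"
    have C: "C > 0" using r by (simp add: C_def)
    have A: "\<exists>N. \<forall>m\<ge>N. \<forall>n\<ge>N. \<forall>y\<in>cball x (r/2). \<forall>v. \<bar>dderiv v (f m) y - dderiv v (f n) y\<bar> \<le> e * norm v"
      if "e > 0" for e
    proof -
      have "e / (2 * C) > 0" using that C by simp
      then obtain N where N: "\<And>n y. n \<ge> N \<Longrightarrow> y \<in> cball x r \<Longrightarrow> \<bar>f n y - F y\<bar> < e / (2 * C)"
        using ul unfolding uniform_limit_sequentially_iff dist_real_def by meson
      have "\<bar>dderiv v (f m) y - dderiv v (f n) y\<bar> \<le> e * norm v"
        if "m \<ge> N" "n \<ge> N" "y \<in> cball x (r/2)" for m n y v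
      proof -
        have "\<bar>dderiv v (\<lambda>z. f m z - f n z) y\<bar> \<le> (real DIM('a))\<^sup>2 * (e / C) / (r/2) * norm v"
        proof (rule gradient_bound)
          fix z assume "z \<in> cball y (r/2)"
          then have "z \<in> cball x r" using sub[OF that(3)] by blast
          then have "\<bar>f m z - F z\<bar> < e / (2 * C)" "\<bar>f n z - F z\<bar> < e / (2 * C)"
            using N that by auto
          moreover have "e / C = e / (2 * C) + e / (2 * C)" using C by (simp add: field_simps)
          ultimately show "\<bar>f m z - f n z\<bar> \<le> e / C" by linarith
        qed (use r in \<open>auto simp: p laplacian_diff l intro!: real_polynomial_function_diff\<close>)
        also have "(real DIM('a))\<^sup>2 * (e / C) / (r/2) = C * (e / C)" by (simp add: C_def)
        also have "\<dots> = e" using C by simp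
        finally show ?thesis by (simp add: dderiv_diff p)
      qed
      then show ?thesis by blast
    qed
    have conv: "(\<lambda>n. dderiv v (f n) y) \<longlonglongrightarrow> G v y" if y: "y \<in> cball x (r/2)" for v y
    proof -
      have "Cauchy (\<lambda>n. dderiv v (f n) y)"
      proof (rule CauchyI)
        fix e :: real assume "e > 0"
        \<comment> \<open>The 1 keeps the denominator positive when \<open>v = 0\<close>; the 2
          makes the final inequality strict.\<close>
        define e' where "e' = e / (2 * (norm v + 1))"
        have pos: "2 * (norm v + 1) > 0" by (smt (verit) norm_ge_zero)
        then have "e' > 0" using \<open>e > 0\<close> by (simp add: e'_def)
        have "e' * norm v \<le> e' * (norm v + 1)" using \<open>e' > 0\<close> by simp
        also have "\<dots> = e / 2" using pos by (simp add: e'_def field_simps)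
        also have "\<dots> < e" using \<open>e > 0\<close> by simp
        finally have "e' * norm v < e" .
        then show "\<exists>M. \<forall>m\<ge>M. \<forall>n\<ge>M. norm (dderiv v (f m) y - dderiv v (f n) y) < e"
          using A[OF \<open>e' > 0\<close>] y unfolding real_norm_def by (meson le_less_trans)
      qed
      then show ?thesis
        unfolding G_def by (simp add: Cauchy_convergent_iff convergent_LIMSEQ_iff)
    qed
    have "\<exists>N. \<forall>n\<ge>N. \<forall>y\<in>cball x (r/2). \<forall>v. \<bar>dderiv v (f n) y - G v y\<bar> \<le> e * norm v"
      if e: "e > 0" for e
    proof -
      obtain N where N: "\<And>m n y v. m \<ge> N \<Longrightarrow> n \<ge> N \<Longrightarrow> y \<in> cball x (r/2) \<Longrightarrow>
          \<bar>dderiv v (f m) y - dderiv v (f n) y\<bar> \<le> e * norm v"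
        using A[OF e] by blast
      have "\<bar>dderiv v (f n) y - G v y\<bar> \<le> e * norm v" if "n \<ge> N" "y \<in> cball x (r/2)" for n y v
      proof (rule tendsto_upperbound)
        show "(\<lambda>m. \<bar>dderiv v (f n) y - dderiv v (f m) y\<bar>) \<longlonglongrightarrow> \<bar>dderiv v (f n) y - G v y\<bar>"
          by (intro tendsto_intros conv that)
        show "\<forall>\<^sub>F m in sequentially. \<bar>dderiv v (f n) y - dderiv v (f m) y\<bar> \<le> e * norm v"
          using eventually_ge_at_top[of N] by eventually_elim (use N that in auto)
      qed simp
      then show ?thesis by blast
    qed
    moreover have "(\<lambda>n. f n y) \<longlonglongrightarrow> F y" if "y \<in> cball x (r/2)" for y
      by (rule tendsto_uniform_limitI[OF ul]) (use that r in auto)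
    moreover have "cball x (r/2) \<subseteq> D" using r by auto
    ultimately show ?thesis using r(1) by (intro exI[of _ "r/2"]) auto
  qed
  show "(F has_derivative (\<lambda>v. G v x)) (at x)" if x: "x \<in> D"
  proof -
    obtain s where s: "s > 0"
      and der: "\<And>e. e > 0 \<Longrightarrow> \<exists>N. \<forall>n\<ge>N. \<forall>y\<in>cball x s. \<forall>v. \<bar>dderiv v (f n) y - G v y\<bar> \<le> e * norm v"
      and F: "\<And>y. y \<in> cball x s \<Longrightarrow> (\<lambda>n. f n y) \<longlonglongrightarrow> F y"
      using core[OF x] by blast
    have xs: "x \<in> ball x s" using s by simp
    have "\<exists>g. \<forall>y\<in>ball x s. (\<lambda>n. f n y) \<longlonglongrightarrow> g y \<and> (g has_derivative (\<lambda>v. G v y)) (at y within ball x s)"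
    proof (rule has_derivative_sequence[where f' = "\<lambda>n y v. dderiv v (f n) y"])
      show "(f n has_derivative (\<lambda>v. dderiv v (f n) y)) (at y within ball x s)" for n y
        by (rule has_derivative_at_withinI[OF poly_has_derivative[OF p]])
      show "(\<lambda>n. f n x) \<longlonglongrightarrow> F x" using F s by simp
      fix e :: real assume "e > 0"
      then obtain N where N: "\<And>n y v. n \<ge> N \<Longrightarrow> y \<in> cball x s \<Longrightarrow> \<bar>dderiv v (f n) y - G v y\<bar> \<le> e * norm v"
        using der by blast
      show "\<forall>\<^sub>F n in sequentially. \<forall>y\<in>ball x s. \<forall>v. norm (dderiv v (f n) y - G v y) \<le> e * norm v"
        using eventually_ge_at_top[of N] by eventually_elim (use N in auto)
    qed (use xs in auto)
    then obtain g where g: "\<And>y. y \<in> ball x s \<Longrightarrow> (\<lambda>n. f n y) \<longlonglongrightarrow> g y"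
      "\<And>y. y \<in> ball x s \<Longrightarrow> (g has_derivative (\<lambda>v. G v y)) (at y within ball x s)"
      by blast
    have "g y = F y" if "y \<in> ball x s" for y
      using LIMSEQ_unique[OF g(1)[OF that] F] that by auto
    moreover have "(g has_derivative (\<lambda>v. G v x)) (at x)"
      using g(2)[OF xs] by (simp add: at_within_open[OF xs])
    ultimately show ?thesis
      using has_derivative_transform_within_open[OF _ open_ball xs] by blast
  qed
  show "locally_uniform_limit D (\<lambda>n. dderiv v (f n)) (G v)"
    unfolding locally_uniform_limit_def
  proof
    fix x assume x: "x \<in> D"
    obtain s where s: "s > 0" "cball x s \<subseteq> D"
      and der: "\<And>e. e > 0 \<Longrightarrow> \<exists>N. \<forall>n\<ge>N. \<forall>y\<in>cball x s. \<forall>v. \<bar>dderiv v (f n) y - G v y\<bar> \<le> e * norm v"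
      using core[OF x] by blast
    have "uniform_limit (cball x s) (\<lambda>n. dderiv v (f n)) (G v) sequentially"
    proof (rule uniform_limitI)
      fix e :: real assume "e > 0"
      define e' where "e' = e / (2 * (norm v + 1))"
      have pos: "2 * (norm v + 1) > 0" by (smt (verit) norm_ge_zero)
      then have "e' > 0" using \<open>e > 0\<close> by (simp add: e'_def)
      have "e' * norm v \<le> e' * (norm v + 1)" using \<open>e' > 0\<close> by simp
      also have "\<dots> = e / 2" using pos by (simp add: e'_def field_simps)
      also have "\<dots> < e" using \<open>e > 0\<close> by simp
      finally have less: "e' * norm v < e" .
      obtain N where N: "\<And>n y v. n \<ge> N \<Longrightarrow> y \<in> cball x s \<Longrightarrow> \<bar>dderiv v (f n) y - G v y\<bar> \<le> e' * norm v"
        using der[OF \<open>e' > 0\<close>] by blast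
      show "\<forall>\<^sub>F n in sequentially. \<forall>y\<in>cball x s. dist (dderiv v (f n) y) (G v y) < e"
        using eventually_ge_at_top[of N]
      proof eventually_elim
        case (elim n)
        show ?case
          using le_less_trans[OF N[OF elim, of _ v] less] by (simp add: dist_real_def)
      qed
    qed
    then show "\<exists>r>0. cball x r \<subseteq> D \<and> uniform_limit (cball x r) (\<lambda>n. dderiv v (f n)) (G v) sequentially"
      using s by blast
  qed
qed

text \<open>The \<open>dderiv v (f n)\<close> are again harmonic polynomials and converge locally
  uniformly to the derivative of \<open>F\<close>, so the induction hypothesis applies to them; for
  this \<open>f\<close> and \<open>F\<close> have to vary.\<close>

lemma Ck_on_harmonic_limit:
  fixes f :: "nat \<Rightarrow> 'a::euclidean_space \<Rightarrow> real"
  assumes "open D" "\<And>n. real_polynomial_function (f n)" "\<And>n x. laplacian (f n) x = 0"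
    "locally_uniform_limit D f F"
  shows "Ck_on k D F"
  using assms(2-)
proof (induction k arbitrary: f F)
  case 0
  have "isCont F x" if "x \<in> D" for x
    using harmonic_limit_derivative(1)[OF 0 that] by (rule has_derivative_continuous)
  then show ?case by (simp add: continuous_at_imp_continuous_on)
next
  case (Suc k)
  define G where "G = (\<lambda>v x. lim (\<lambda>n. dderiv v (f n) x))"
  have G: "(F has_derivative (\<lambda>v. G v x)) (at x)" if "x \<in> D" for x
    unfolding G_def by (rule harmonic_limit_derivative(1)[OF Suc.prems that])
  have lG: "locally_uniform_limit D (\<lambda>n. dderiv v (f n)) (G v)" for v
    unfolding G_def by (rule harmonic_limit_derivative(2)[OF Suc.prems])
  have lap: "laplacian (dderiv v (f n)) x = 0" for v n x
  proof -
    have "laplacian (f n) = (\<lambda>x. 0)" using Suc.prems(2) by auto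
    then show ?thesis using laplacian_dderiv[OF Suc.prems(1)] by simp
  qed
  have CG: "Ck_on k D (G v)" for v
    by (rule Suc.IH[OF _ _ lG]) (auto intro: poly_dderiv Suc.prems(1) lap)
  have "Ck_on k D (\<lambda>x. frechet_derivative F (at x) v)" for v
    by (rule Ck_on_cong[OF \<open>open D\<close> _ CG]) (rule fun_cong[OF frechet_derivative_at[OF G]])
  moreover have "F differentiable (at x)" if "x \<in> D" for x
    using G[OF that] unfolding differentiable_def by blast
  ultimately show ?case by simp
qed

text \<open>Second derivatives of the \<open>f n\<close> converge to those of \<open>F\<close>, and
  with them the Laplacians, all of which are zero.\<close>

lemma has_laplacian_harmonic_limit:
  fixes f :: "nat \<Rightarrow> 'a::euclidean_space \<Rightarrow> real"
  assumes p: "\<And>n. real_polynomial_function (f n)" and l: "\<And>n x. laplacian (f n) x = 0"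
    and lim: "locally_uniform_limit D f F"
  shows "has_laplacian F (\<lambda>x. 0) D"
proof -
  define G where "G = (\<lambda>v x. lim (\<lambda>n. dderiv v (f n) x))"
  define H where "H = (\<lambda>b v x. lim (\<lambda>n. dderiv v (dderiv b (f n)) x))"
  have lG: "locally_uniform_limit D (\<lambda>n. dderiv v (f n)) (G v)" for v
    unfolding G_def by (rule harmonic_limit_derivative(2)[OF assms])
  have p': "real_polynomial_function (dderiv v (f n))" for v n by (rule poly_dderiv[OF p])
  have l': "laplacian (dderiv v (f n)) x = 0" for v n x
  proof -
    have "laplacian (f n) = (\<lambda>x. 0)" using l by auto
    then show ?thesis using laplacian_dderiv[OF p] by simp
  qed
  show ?thesis
  proof (rule has_laplacianI[where f' = "\<lambda>x v. G v x" and f'' = "\<lambda>b x v. H b v x"])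
    fix x assume x: "x \<in> D"
    show "(F has_derivative (\<lambda>v. G v x)) (at x)"
      unfolding G_def by (rule harmonic_limit_derivative(1)[OF assms x])
    show "(G b has_derivative (\<lambda>v. H b v x)) (at x)" for b
      unfolding H_def by (rule harmonic_limit_derivative(1)[OF p' l' lG x])
    have "locally_uniform_limit D (\<lambda>n. dderiv b (dderiv b (f n))) (H b b)" for b
      unfolding H_def by (rule harmonic_limit_derivative(2)[OF p' l' lG])
    then have "(\<lambda>n. dderiv b (dderiv b (f n)) x) \<longlonglongrightarrow> H b b x" for b
      using x tendsto_uniform_limitI unfolding locally_uniform_limit_def
      by (metis centre_in_cball less_imp_le)
    then have "(\<lambda>n. laplacian (f n) x) \<longlonglongrightarrow> (\<Sum>b\<in>Basis. H b b x)"
      unfolding laplacian_def by (intro tendsto_sum)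
    then show "0 = (\<Sum>b\<in>Basis. H b b x)" by (simp add: l LIMSEQ_const_iff)
  qed
qed

section \<open>The Dirichlet problem on a ball\<close>

lemma dirichlet_ball:
  fixes g :: "'a::euclidean_space \<Rightarrow> real"
  assumes r: "r > 0" and g: "continuous_on (sphere a r) g"
  obtains h where "continuous_on (cball a r) h" "\<And>x. x \<in> sphere a r \<Longrightarrow> h x = g x"
    "smooth_on (ball a r) h" "has_laplacian h (\<lambda>x. 0) (ball a r)"
proof -
  have "\<exists>h. real_polynomial_function h \<and> (\<forall>x. laplacian h x = 0) \<and>
      (\<forall>x\<in>sphere a r. \<bar>g x - h x\<bar> < inverse (real (Suc n)))" for n
  proof -
    have "inverse (real (Suc n)) > 0" by simp
    then obtain p where p: "real_polynomial_function p"
      "\<And>x. x \<in> sphere a r \<Longrightarrow> \<bar>g x - p x\<bar> < inverse (real (Suc n))"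
      using Stone_Weierstrass_real_polynomial_function[OF compact_sphere g] by blast
    obtain h where "real_polynomial_function h" "\<And>x. laplacian h x = 0"
      "\<And>x. x \<in> sphere a r \<Longrightarrow> h x = p x"
      using poly_dirichlet_sphere[OF p(1)] by blast
    with p(2) show ?thesis by (intro exI[of _ h]) auto
  qed
  then obtain f where p: "\<And>n. real_polynomial_function (f n)" and l: "\<And>n x. laplacian (f n) x = 0"
    and fg: "\<And>n x. x \<in> sphere a r \<Longrightarrow> \<bar>g x - f n x\<bar> < inverse (real (Suc n))"
    by metis
  have fc: "continuous_on T (f n)" for T n
    using p by (simp add: continuous_on_polymonial_function real_polynomial_function_eq)
  have fl: "has_laplacian (f n) (\<lambda>x. 0) T" for T n
  proof -
    have "laplacian (f n) = (\<lambda>x. 0)" using l by auto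
    then show ?thesis using poly_has_laplacian[OF p] by metis
  qed
  have cl: "closure (ball a r) = cball a r" and fr: "frontier (ball a r) = sphere a r"
    using r by auto
  \<comment> \<open>On the sphere both polynomials are within \<open>inverse (real (Suc N))\<close>
    of \<open>g\<close>, so they differ by at most twice that; the maximum principle carries this
    into the ball.\<close>
  have diff: "f m x \<le> f n x + 2 * inverse (real (Suc N))" if "m \<ge> N" "n \<ge> N" "x \<in> cball a r" for m n N x
  proof (rule harmonic_le[OF open_ball bounded_ball,
        where f = "f m" and g = "\<lambda>x. f n x + 2 * inverse (real (Suc N))"])
    have "has_laplacian (\<lambda>x. f n x + 2 * inverse (real (Suc N))) (\<lambda>x. 0 + 0) (ball a r)"
      by (intro has_laplacian_add fl has_laplacian_const)
    then show "has_laplacian (\<lambda>x. f n x + 2 * inverse (real (Suc N))) (\<lambda>x. 0) (ball a r)" by simp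
    show "f m x \<le> f n x + 2 * inverse (real (Suc N))" if "x \<in> frontier (ball a r)" for x
    proof -
      have "inverse (real (Suc m)) \<le> inverse (real (Suc N))" "inverse (real (Suc n)) \<le> inverse (real (Suc N))"
        using \<open>m \<ge> N\<close> \<open>n \<ge> N\<close> by (auto simp: field_simps)
      then show ?thesis using fg[of x m] fg[of x n] that unfolding fr by linarith
    qed
  qed (use that in \<open>auto intro!: continuous_intros fc fl simp: cl\<close>)
  have "uniformly_Cauchy_on (cball a r) f"
  proof (rule uniformly_Cauchy_onI)
    fix e :: real assume "e > 0"
    then obtain N where N: "inverse (real (Suc N)) < e / 2"
      using reals_Archimedean[of "e/2"] by auto
    show "\<exists>M. \<forall>x\<in>cball a r. \<forall>m\<ge>M. \<forall>n\<ge>M. dist (f m x) (f n x) < e"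
    proof (intro exI ballI allI impI)
      fix x m n assume "x \<in> cball a r" "N \<le> m" "N \<le> n"
      then show "dist (f m x) (f n x) < e"
        using diff[of N m n x] diff[of N n m x] N by (auto simp: dist_real_def)
    qed
  qed
  then obtain h where h: "uniform_limit (cball a r) f h sequentially"
    using Cauchy_uniformly_convergent unfolding uniformly_convergent_on_def by blast
  have loc: "locally_uniform_limit (ball a r) f h"
    unfolding locally_uniform_limit_def
  proof
    fix x assume "x \<in> ball a r"
    then obtain s where s: "s > 0" "cball x s \<subseteq> ball a r"
      by (meson open_ball open_contains_cball)
    then have "uniform_limit (cball x s) f h sequentially"
      by (intro uniform_limit_on_subset[OF h]) auto
    with s show "\<exists>s>0. cball x s \<subseteq> ball a r \<and> uniform_limit (cball x s) f h sequentially" by blast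
  qed
  show ?thesis
  proof (rule that)
    show "continuous_on (cball a r) h"
      by (rule uniform_limit_theorem[OF _ h]) (auto simp: fc)
    show "h x = g x" if x: "x \<in> sphere a r" for x
    proof (rule LIMSEQ_unique)
      show "(\<lambda>n. f n x) \<longlonglongrightarrow> h x"
        by (rule tendsto_uniform_limitI[OF h]) (use x in auto)
      have "(\<lambda>n. f n x - g x) \<longlonglongrightarrow> 0"
        by (rule Lim_null_comparison[OF _ LIMSEQ_inverse_real_of_nat])
           (use fg[OF x] in \<open>auto intro!: always_eventually less_imp_le simp: abs_minus_commute\<close>)
      then show "(\<lambda>n. f n x) \<longlonglongrightarrow> g x" by (simp add: LIM_zero_iff)
    qed
    show "smooth_on (ball a r) h"
      unfolding smooth_on_def using Ck_on_harmonic_limit[OF open_ball p l loc] by blast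
    show "has_laplacian h (\<lambda>x. 0) (ball a r)"
      by (rule has_laplacian_harmonic_limit[OF p l loc])
  qed
qed

section \<open>Perron's method on convex regions\<close>

text \<open>On an open set the witnesses in \<open>has_laplacian\<close> are forced to be the
  Frechet derivatives. The predicate thereby becomes pointwise, which gives locality, and
  \<open>l\<close> becomes unique on \<open>D\<close>.\<close>

lemma has_laplacian_iff:
  assumes "open D"
  shows "has_laplacian f l D \<longleftrightarrow> (\<forall>x\<in>D. f differentiable (at x) \<and>
    (\<forall>b\<in>Basis. (\<lambda>y. frechet_derivative f (at y) b) differentiable (at x)) \<and>
    l x = (\<Sum>b\<in>Basis. frechet_derivative (\<lambda>y. frechet_derivative f (at y) b) (at x) b))"
    (is "?L \<longleftrightarrow> ?R")
proof
  assume ?L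
  then obtain f' f'' where f: "\<And>x. x \<in> D \<Longrightarrow> (f has_derivative f' x) (at x)"
    "\<And>x b. x \<in> D \<Longrightarrow> b \<in> Basis \<Longrightarrow> ((\<lambda>y. f' y b) has_derivative f'' b x) (at x)"
    "\<And>x. x \<in> D \<Longrightarrow> l x = (\<Sum>b\<in>Basis. f'' b x b)"
    using has_laplacianE by blast
  have f': "f' x = frechet_derivative f (at x)" if "x \<in> D" for x
    by (rule frechet_derivative_at[OF f(1)[OF that]])
  have f'': "((\<lambda>y. frechet_derivative f (at y) b) has_derivative f'' b x) (at x)"
    if "x \<in> D" "b \<in> Basis" for x b
    by (rule has_derivative_transform_within_open[OF f(2)[OF that] assms that(1)]) (simp add: f')
  show ?R
  proof (intro ballI conjI)
    fix x assume x: "x \<in> D"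
    show "f differentiable (at x)" by (rule differentiableI[OF f(1)[OF x]])
    show "(\<lambda>y. frechet_derivative f (at y) b) differentiable (at x)" if "b \<in> Basis" for b
      by (rule differentiableI[OF f''[OF x that]])
    show "l x = (\<Sum>b\<in>Basis. frechet_derivative (\<lambda>y. frechet_derivative f (at y) b) (at x) b)"
      unfolding f(3)[OF x] by (intro sum.cong refl fun_cong[OF frechet_derivative_at[OF f''[OF x]]])
  qed
next
  assume ?R
  then show ?L
    by (intro has_laplacianI[where f' = "\<lambda>x. frechet_derivative f (at x)"
          and f'' = "\<lambda>b x. frechet_derivative (\<lambda>y. frechet_derivative f (at y) b) (at x)"])
       (auto simp: frechet_derivative_works[symmetric])
qed

lemma has_laplacian_local:
  assumes "open D" "\<And>x. x \<in> D \<Longrightarrow> \<exists>T. open T \<and> x \<in> T \<and> has_laplacian f l T"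
  shows "has_laplacian f l D"
  unfolding has_laplacian_iff[OF assms(1)]
proof
  fix x assume "x \<in> D"
  then obtain T where T: "open T" "x \<in> T" "has_laplacian f l T" using assms(2) by blast
  show "f differentiable (at x) \<and>
    (\<forall>b\<in>Basis. (\<lambda>y. frechet_derivative f (at y) b) differentiable (at x)) \<and>
    l x = (\<Sum>b\<in>Basis. frechet_derivative (\<lambda>y. frechet_derivative f (at y) b) (at x) b)"
    using T(2,3) unfolding has_laplacian_iff[OF T(1)] by simp
qed

text \<open>Subharmonicity is tested against harmonic functions on all open subsets, not only on balls;
  this makes it stable under gluing without any strong maximum principle.\<close>

definition subharmonic :: "'a::euclidean_space set \<Rightarrow> ('a \<Rightarrow> real) \<Rightarrow> bool" where
  "subharmonic S v \<longleftrightarrow> (\<forall>D h. open D \<longrightarrow> D \<subseteq> S \<longrightarrow> continuous_on (closure D) h \<longrightarrow>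
     has_laplacian h (\<lambda>x. 0) D \<longrightarrow> (\<forall>x\<in>frontier D. v x \<le> h x) \<longrightarrow> (\<forall>x\<in>D. v x \<le> h x))"

lemma subharmonicD:
  assumes "subharmonic S v" "open D" "D \<subseteq> S" "continuous_on (closure D) h"
    "has_laplacian h (\<lambda>x. 0) D" "\<And>x. x \<in> frontier D \<Longrightarrow> v x \<le> h x" "x \<in> D"
  shows "v x \<le> h x"
  using assms(1)[unfolded subharmonic_def, rule_format, OF assms(2-7)] .

section \<open>Examples of subharmonic functions and operations preserving them\<close>

lemma harmonic_imp_subharmonic:
  assumes "bounded S" "continuous_on (closure S) v" "has_laplacian v (\<lambda>x. 0) S"
  shows "subharmonic S v"
  unfolding subharmonic_def
proof (intro allI impI ballI)
  fix D h x
  assume *: "open D" "D \<subseteq> S" "continuous_on (closure D) h" "has_laplacian h (\<lambda>x. 0) D"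
    "\<forall>x\<in>frontier D. v x \<le> h x" "x \<in> D"
  show "v x \<le> h x"
  proof (rule harmonic_le[OF *(1) _ _ *(3) _ *(4)])
    show "bounded D" by (rule bounded_subset[OF assms(1) *(2)])
    show "continuous_on (closure D) v"
      by (rule continuous_on_subset[OF assms(2) closure_mono[OF *(2)]])
    show "has_laplacian v (\<lambda>x. 0) D" by (rule has_laplacian_subset[OF assms(3) *(2)])
    show "x \<in> closure D" using *(6) closure_subset by blast
  qed (use *(5) in blast)
qed

text \<open>The test only compares values, so a supremum passes it when each member does.
  Boundedness is asked on \<open>closure S\<close> because the frontier of a test set may touch the
  frontier of \<open>S\<close>.\<close>

lemma subharmonic_SUP:
  assumes "F \<noteq> {}" "\<And>v. v \<in> F \<Longrightarrow> subharmonic S v"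
    and bdd: "\<And>x. x \<in> closure S \<Longrightarrow> bdd_above ((\<lambda>v. v x) ` F)"
  shows "subharmonic S (\<lambda>x. SUP v\<in>F. v x)"
  unfolding subharmonic_def
proof (intro allI impI ballI)
  fix D h x
  assume *: "open D" "D \<subseteq> S" "continuous_on (closure D) h" "has_laplacian h (\<lambda>x. 0) D"
    "\<forall>x\<in>frontier D. (SUP v\<in>F. v x) \<le> h x" "x \<in> D"
  show "(SUP v\<in>F. v x) \<le> h x"
  proof (rule cSUP_least[OF assms(1)])
    fix v assume v: "v \<in> F"
    show "v x \<le> h x"
    proof (rule subharmonicD[OF assms(2)[OF v] *(1-4) _ *(6)])
      fix y assume y: "y \<in> frontier D"
      then have "y \<in> closure S" using closure_mono[OF *(2)] by (auto simp: frontier_def)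
      then have "v y \<le> (SUP v\<in>F. v y)" using bdd v by (intro cSUP_upper)
      then show "v y \<le> h y" using *(5) y by force
    qed
  qed
qed

lemma subharmonic_max:
  assumes "subharmonic S v" "subharmonic S w"
  shows "subharmonic S (\<lambda>x. max (v x) (w x))"
  unfolding subharmonic_def
proof (intro allI impI ballI)
  fix D h x
  assume *: "open D" "D \<subseteq> S" "continuous_on (closure D) h" "has_laplacian h (\<lambda>x. 0) D"
    and fr: "\<forall>x\<in>frontier D. max (v x) (w x) \<le> h x" and x: "x \<in> D"
  have "v x \<le> h x" by (rule subharmonicD[OF assms(1) * _ x]) (use fr in auto)
  moreover have "w x \<le> h x" by (rule subharmonicD[OF assms(2) * _ x]) (use fr in auto)
  ultimately show "max (v x) (w x) \<le> h x" by simp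
qed

lemma translation_image: "{x. x + y \<in> S} = (\<lambda>x. - y + x) ` S" for y :: "'a::ab_group_add"
  by (auto simp: image_iff) (metis add.commute add_diff_cancel_left' diff_conv_add_uminus)

lemma subharmonic_translate:
  assumes "subharmonic S v"
  shows "subharmonic {x. x + y \<in> S} (\<lambda>x. v (x + y) - c)"
  unfolding subharmonic_def
proof (intro allI impI ballI)
  fix D h x
  assume *: "open D" "D \<subseteq> {x. x + y \<in> S}" "continuous_on (closure D) h" "has_laplacian h (\<lambda>x. 0) D"
    "\<forall>x\<in>frontier D. v (x + y) - c \<le> h x" "x \<in> D"
  define E where "E = {x. x + (- y) \<in> D}"
  have E: "E = (\<lambda>x. y + x) ` D" unfolding E_def translation_image by simp
  have "v (x + y) \<le> h (x + y + (- y)) + c"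
  proof (rule subharmonicD[OF assms, where D = E and h = "\<lambda>z. h (z + (- y)) + c"])
    show "open E" unfolding E by (rule open_translation[OF *(1)])
    show "E \<subseteq> S" using *(2) by (auto simp: E_def)
    have cl: "closure E = (\<lambda>x. y + x) ` closure D" unfolding E by (rule closure_translation)
    have fr: "frontier E = (\<lambda>x. y + x) ` frontier D" unfolding E by (rule frontier_translation)
    show "continuous_on (closure E) (\<lambda>z. h (z + (- y)) + c)"
      unfolding cl by (intro continuous_intros continuous_on_compose2[OF *(3)]) auto
    have "has_laplacian (\<lambda>z. h (z + (- y)) + c) (\<lambda>x. 0 + 0) E"
      unfolding E_def by (intro has_laplacian_add has_laplacian_const has_laplacian_translate[OF *(4)])
    then show "has_laplacian (\<lambda>z. h (z + (- y)) + c) (\<lambda>x. 0) E" by simp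
    show "v z \<le> h (z + (- y)) + c" if "z \<in> frontier E" for z
      using that *(5) unfolding fr by (force simp: add.commute)
    show "x + y \<in> E" using *(6) by (simp add: E_def)
  qed
  then show "v (x + y) - c \<le> h x" by simp
qed

text \<open>First \<open>v \<le> h\<close> on \<open>D\<close>. Then \<open>w\<close> is compared
  with \<open>h\<close> on \<open>D \<inter> E\<close>: at frontier points inside \<open>D\<close>
  one has \<open>w \<le> v \<le> h\<close>, and at the others the glued function, which dominates
  \<open>w\<close> there, is below \<open>h\<close> by hypothesis.\<close>

lemma subharmonic_glue:
  assumes v: "subharmonic S v" and w: "subharmonic E w" and "open E"
    and wv: "\<And>x. x \<in> frontier E \<Longrightarrow> x \<in> S \<Longrightarrow> w x \<le> v x"
  shows "subharmonic S (\<lambda>x. if x \<in> closure E then max (v x) (w x) else v x)"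
  unfolding subharmonic_def
proof (intro allI impI ballI)
  let ?u = "\<lambda>x. if x \<in> closure E then max (v x) (w x) else v x"
  fix D h x
  assume *: "open D" "D \<subseteq> S" "continuous_on (closure D) h" "has_laplacian h (\<lambda>x. 0) D"
    and fr: "\<forall>x\<in>frontier D. ?u x \<le> h x" and x: "x \<in> D"
  have vh: "v y \<le> h y" if "y \<in> D" for y
    by (rule subharmonicD[OF v * _ that]) (use fr in \<open>fastforce split: if_splits\<close>)
  have wh: "w y \<le> h y" if y: "y \<in> D \<inter> E" for y
  proof (rule subharmonicD[OF w _ _ _ _ _ y])
    show "open (D \<inter> E)" using * \<open>open E\<close> by auto
    show "continuous_on (closure (D \<inter> E)) h"
      by (rule continuous_on_subset[OF *(3)]) (simp add: closure_mono)
    show "has_laplacian h (\<lambda>x. 0) (D \<inter> E)" by (rule has_laplacian_subset[OF *(4)]) auto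
    fix z assume z: "z \<in> frontier (D \<inter> E)"
    have zcl: "z \<in> closure D" "z \<in> closure E"
      using z closure_mono[of "D \<inter> E" D] closure_mono[of "D \<inter> E" E] by (auto simp: frontier_def)
    have zn: "z \<notin> D \<inter> E"
      using z *(1) \<open>open E\<close> by (auto simp: frontier_def interior_open)
    show "w z \<le> h z"
    proof (cases "z \<in> D")
      case True
      then have "z \<in> frontier E" using zn zcl \<open>open E\<close> by (auto simp: frontier_def interior_open)
      then show ?thesis using wv[of z] vh[OF True] True *(2) by force
    next
      case False
      then have "z \<in> frontier D" using zcl *(1) by (auto simp: frontier_def interior_open)
      then show ?thesis using fr zcl by fastforce
    qed
  qed auto
  show "?u x \<le> h x"
  proof (cases "x \<in> E")
    case True
    then show ?thesis using vh[OF x] wh[of x] x by auto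
  next
    case False
    show ?thesis
    proof (cases "x \<in> closure E")
      case True
      then have "x \<in> frontier E" using False \<open>open E\<close> by (auto simp: frontier_def interior_open)
      then show ?thesis using wv[of x] vh[OF x] x *(2) by force
    qed (use vh[OF x] in auto)
  qed
qed

text \<open>Testing \<open>v\<close> on the ball itself gives \<open>v \<le> h0\<close>. For the
  replaced function, \<open>h0\<close> and \<open>h\<close> are compared on
  \<open>D \<inter> ball a r\<close>: its frontier points in \<open>D\<close> lie on the sphere,
  where \<open>h0 = v\<close>, and the others are frontier points of \<open>D\<close>.\<close>

lemma subharmonic_lift:
  assumes v: "subharmonic S v" and S: "cball a r \<subseteq> S" and r: "r > 0"
    and h0: "continuous_on (cball a r) h0" "has_laplacian h0 (\<lambda>x. 0) (ball a r)"
      "\<And>x. x \<in> sphere a r \<Longrightarrow> h0 x = v x"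
  shows "x \<in> ball a r \<Longrightarrow> v x \<le> h0 x"
    and "subharmonic S (\<lambda>x. if x \<in> ball a r then h0 x else v x)"
proof -
  have cl: "closure (ball a r) = cball a r" and frb: "frontier (ball a r) = sphere a r"
    using r by auto
  have bS: "ball a r \<subseteq> S" using S by auto
  show le: "v x \<le> h0 x" if "x \<in> ball a r" for x
    by (rule subharmonicD[OF v open_ball bS _ h0(2) _ that]) (use h0 in \<open>auto simp: cl frb\<close>)
  show "subharmonic S (\<lambda>x. if x \<in> ball a r then h0 x else v x)"
    unfolding subharmonic_def
  proof (intro allI impI ballI)
    let ?u = "\<lambda>x. if x \<in> ball a r then h0 x else v x"
    fix D h x
    assume *: "open D" "D \<subseteq> S" "continuous_on (closure D) h" "has_laplacian h (\<lambda>x. 0) D"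
      and fr: "\<forall>x\<in>frontier D. ?u x \<le> h x" and x: "x \<in> D"
    have vu: "v y \<le> ?u y" for y using le by auto
    have vh: "v y \<le> h y" if "y \<in> D" for y
      by (rule subharmonicD[OF v * _ that]) (use fr vu order_trans in blast)
    show "?u x \<le> h x"
    proof (cases "x \<in> ball a r")
      case True
      have sub: "D \<inter> ball a r \<subseteq> D" "D \<inter> ball a r \<subseteq> ball a r" by auto
      have cls: "closure (D \<inter> ball a r) \<subseteq> closure D" "closure (D \<inter> ball a r) \<subseteq> cball a r"
        using closure_mono[OF sub(1)] closure_mono[OF sub(2)] unfolding cl by auto
      have "open (D \<inter> ball a r)" using *(1) by auto
      have "h0 x \<le> h x"
      proof (rule harmonic_le[where D = "D \<inter> ball a r"])
        show "open (D \<inter> ball a r)" by fact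
        show "bounded (D \<inter> ball a r)" by (simp add: bounded_Int)
        show "continuous_on (closure (D \<inter> ball a r)) h0" by (rule continuous_on_subset[OF h0(1) cls(2)])
        show "continuous_on (closure (D \<inter> ball a r)) h" by (rule continuous_on_subset[OF *(3) cls(1)])
        show "has_laplacian h0 (\<lambda>x. 0) (D \<inter> ball a r)" by (rule has_laplacian_subset[OF h0(2) sub(2)])
        show "has_laplacian h (\<lambda>x. 0) (D \<inter> ball a r)" by (rule has_laplacian_subset[OF *(4) sub(1)])
        show "x \<in> closure (D \<inter> ball a r)"
          by (rule subsetD[OF closure_subset]) (use x True in simp)
        fix z assume z: "z \<in> frontier (D \<inter> ball a r)"
        have zcl: "z \<in> closure D" "z \<in> cball a r" using z cls by (auto simp: frontier_def)
        have zn: "z \<notin> D \<inter> ball a r"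
          using z *(1) by (auto simp: frontier_def interior_open)
        show "h0 z \<le> h z"
        proof (cases "z \<in> D")
          case True
          then have "z \<in> sphere a r" using zn zcl by auto
          then show ?thesis using h0(3) vh[OF True] by simp
        next
          case False
          then have "z \<in> frontier D" using zcl *(1) by (auto simp: frontier_def interior_open)
          then have "?u z \<le> h z" using fr by blast
          moreover have "h0 z = ?u z" using h0(3)[of z] zcl by auto
          ultimately show ?thesis by simp
        qed
      qed
      then show ?thesis using True by simp
    qed (use vh[OF x] in simp)
  qed
qed

text \<open>Weaker than equicontinuity: \<open>v y\<close> is compared with the supremum at
  \<open>x\<close>, not with \<open>v x\<close>. One-sidedness is enough because \<open>x\<close>
  and \<open>y\<close> can be exchanged.\<close>

lemma continuous_on_SUP_equicontinuous:
  fixes F :: "('a::metric_space \<Rightarrow> real) set"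
  assumes "F \<noteq> {}"
    and equi: "\<And>e. e > 0 \<Longrightarrow> \<exists>d>0. \<forall>v\<in>F. \<forall>x\<in>X. \<forall>y\<in>X. dist x y < d \<longrightarrow> v y \<le> (SUP w\<in>F. w x) + e"
  shows "continuous_on X (\<lambda>x. SUP v\<in>F. v x)"
  unfolding continuous_on_iff
proof (intro ballI allI impI)
  fix x and e :: real assume x: "x \<in> X" and "e > 0"
  then obtain d where d: "d > 0"
    "\<And>v x y. v \<in> F \<Longrightarrow> x \<in> X \<Longrightarrow> y \<in> X \<Longrightarrow> dist x y < d \<Longrightarrow> v y \<le> (SUP w\<in>F. w x) + e / 2"
    using equi[of "e / 2"] by (metis half_gt_zero)
  have le: "(SUP w\<in>F. w y) \<le> (SUP w\<in>F. w x) + e / 2" if "x \<in> X" "y \<in> X" "dist x y < d" for x y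
    by (rule cSUP_least[OF assms(1)]) (use d(2) that in auto)
  show "\<exists>d>0. \<forall>y\<in>X. dist y x < d \<longrightarrow> dist (SUP v\<in>F. v y) (SUP v\<in>F. v x) < e"
  proof (intro exI[of _ d] conjI ballI impI d(1))
    fix y assume "y \<in> X" "dist y x < d"
    then show "dist (SUP v\<in>F. v y) (SUP v\<in>F. v x) < e"
      using le[OF x, of y] le[OF _ x, of y] \<open>e > 0\<close> by (auto simp: dist_real_def dist_commute)
  qed
qed

text \<open>The two terms are differences of squares and
  \<open>s * (d - s) - t * (d - t) = (s - t) * (d - s - t)\<close>. The constant depends on neither
  \<open>p\<close> nor \<open>c\<close>, so that a supremum of barriers over all boundary points
  stays continuous.\<close>

lemma barrier_lipschitz:
  fixes p c x y :: "'a::euclidean_space"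
  assumes "norm c = 1" "0 \<le> d" "norm (x - p) \<le> d" "norm (y - p) \<le> d"
    "0 \<le> c \<bullet> (x - p)" "0 \<le> c \<bullet> (y - p)"
  shows "\<bar>barrier p c d x - barrier p c d y\<bar> \<le> (2 * d + real DIM('a) * d) * norm (x - y)"
proof -
  let ?s = "c \<bullet> (x - p)" and ?t = "c \<bullet> (y - p)" and ?n = "real DIM('a)"
  have s: "?s \<le> d" "?t \<le> d"
    using assms Cauchy_Schwarz_ineq2[of c "x - p"] Cauchy_Schwarz_ineq2[of c "y - p"] by auto
  have "\<bar>?s - ?t\<bar> \<le> norm (x - y)"
    using Cauchy_Schwarz_ineq2[of c "x - y"] assms(1) by (simp add: inner_diff_right)
  moreover have "\<bar>d - ?s - ?t\<bar> \<le> d" using s assms by (auto simp: abs_le_iff)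
  ultimately have 1: "\<bar>?s - ?t\<bar> * \<bar>d - ?s - ?t\<bar> \<le> norm (x - y) * d"
    by (intro mult_mono) auto
  have "\<bar>norm (x - p) - norm (y - p)\<bar> \<le> norm (x - y)"
    using norm_triangle_ineq3[of "x - p" "y - p"] by simp
  moreover have "\<bar>norm (x - p) + norm (y - p)\<bar> \<le> 2 * d" using assms by simp
  ultimately have 2: "\<bar>norm (x - p) - norm (y - p)\<bar> * \<bar>norm (x - p) + norm (y - p)\<bar> \<le> norm (x - y) * (2 * d)"
    by (intro mult_mono) auto
  have "barrier p c d x - barrier p c d y =
      (norm (x - p) - norm (y - p)) * (norm (x - p) + norm (y - p)) + ?n * ((?s - ?t) * (d - ?s - ?t))"
    unfolding barrier_def by algebra
  also have "\<bar>\<dots>\<bar> \<le> \<bar>norm (x - p) - norm (y - p)\<bar> * \<bar>norm (x - p) + norm (y - p)\<bar>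
      + ?n * (\<bar>?s - ?t\<bar> * \<bar>d - ?s - ?t\<bar>)"
    by (rule order_trans[OF abs_triangle_ineq]) (simp add: abs_mult)
  also have "\<dots> \<le> norm (x - y) * (2 * d) + ?n * (norm (x - y) * d)"
    by (intro add_mono mult_left_mono 1 2) auto
  finally show ?thesis by (simp add: algebra_simps)
qed

text \<open>Uniform continuity handles points closer than some \<open>\<delta>\<close>; beyond it
  the oscillation, at most \<open>2 * A\<close>, is absorbed by the quadratic term. One
  \<open>C\<close> serves all \<open>p\<close>.\<close>

lemma continuous_quadratic_modulus:
  fixes \<alpha> :: "'a::real_normed_vector \<Rightarrow> real"
  assumes "compact B" "continuous_on B \<alpha>" "e > 0"
  obtains C where "C \<ge> 0" "\<And>p x. p \<in> B \<Longrightarrow> x \<in> B \<Longrightarrow> \<bar>\<alpha> x - \<alpha> p\<bar> \<le> e + C * (norm (x - p))\<^sup>2"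
proof -
  have "bounded (\<alpha> ` B)" by (intro compact_imp_bounded compact_continuous_image assms)
  then obtain A where A: "A > 0" "\<And>x. x \<in> B \<Longrightarrow> \<bar>\<alpha> x\<bar> \<le> A"
    unfolding bounded_pos by auto
  have "uniformly_continuous_on B \<alpha>" by (rule compact_uniformly_continuous[OF assms(2,1)])
  then obtain \<delta> where \<delta>: "\<delta> > 0" "\<And>p x. p \<in> B \<Longrightarrow> x \<in> B \<Longrightarrow> dist x p < \<delta> \<Longrightarrow> dist (\<alpha> x) (\<alpha> p) < e"
    unfolding uniformly_continuous_on_def using \<open>e > 0\<close> by metis
  show ?thesis
  proof (rule that[of "2 * A / \<delta>\<^sup>2"])
    show "2 * A / \<delta>\<^sup>2 \<ge> 0" using A by simp
    fix p x assume px: "p \<in> B" "x \<in> B"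
    show "\<bar>\<alpha> x - \<alpha> p\<bar> \<le> e + 2 * A / \<delta>\<^sup>2 * (norm (x - p))\<^sup>2"
    proof (cases "norm (x - p) < \<delta>")
      case True
      then have "\<bar>\<alpha> x - \<alpha> p\<bar> \<le> e" using \<delta>(2)[OF px] by (simp add: dist_norm)
      moreover have "2 * A / \<delta>\<^sup>2 * (norm (x - p))\<^sup>2 \<ge> 0" using A by simp
      ultimately show ?thesis by simp
    next
      case False
      then have "\<delta>\<^sup>2 \<le> (norm (x - p))\<^sup>2" using \<delta>(1) by (intro power_mono) auto
      then have "2 * A * \<delta>\<^sup>2 \<le> 2 * A * (norm (x - p))\<^sup>2" using A by simp
      then have "2 * A \<le> 2 * A / \<delta>\<^sup>2 * (norm (x - p))\<^sup>2"
        using \<delta>(1) by (simp add: field_simps)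
      then show ?thesis using A(2)[OF px(1)] A(2)[OF px(2)] \<open>e > 0\<close> by linarith
    qed
  qed
qed

section \<open>Supporting normals and Perron's construction on a convex region\<close>

lemma convex_supporting_normals:
  fixes S :: "'a::euclidean_space set"
  assumes "convex S" "open S"
  obtains c where "\<And>p. p \<in> frontier S \<Longrightarrow> norm (c p) = 1"
    "\<And>p x. p \<in> frontier S \<Longrightarrow> x \<in> closure S \<Longrightarrow> 0 \<le> c p \<bullet> (x - p)"
proof -
  have "\<exists>c. norm c = 1 \<and> (\<forall>x\<in>closure S. 0 \<le> c \<bullet> (x - p))" if p: "p \<in> frontier S" for p
  proof -
    have "p \<in> closure S" "p \<notin> rel_interior S"
      using p assms(2) by (auto simp: frontier_def rel_interior_open interior_open)
    then obtain a where a: "a \<noteq> 0" "\<And>y. y \<in> closure S \<Longrightarrow> a \<bullet> p \<le> a \<bullet> y"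
      using supporting_hyperplane_relative_frontier[OF assms(1)] by metis
    show ?thesis
    proof (intro exI[of _ "a /\<^sub>R norm a"] conjI ballI)
      fix x assume "x \<in> closure S"
      then show "0 \<le> (a /\<^sub>R norm a) \<bullet> (x - p)"
        using a(2)[of x] by (simp add: inner_diff_right mult_left_mono)
    qed (use a in simp)
  qed
  then have "\<exists>c. \<forall>p\<in>frontier S. norm (c p) = 1 \<and> (\<forall>x\<in>closure S. 0 \<le> c p \<bullet> (x - p))"
    by (intro bchoice) blast
  then show ?thesis using that by blast
qed

lemma dirichlet_convex:
  fixes \<Omega> :: "'a::euclidean_space set" and \<alpha> :: "'a \<Rightarrow> real"
  assumes "open \<Omega>" "bounded \<Omega>" "convex \<Omega>" "\<Omega> \<noteq> {}" and \<alpha>: "continuous_on (frontier \<Omega>) \<alpha>"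
  obtains u where "continuous_on (closure \<Omega>) u" "\<And>x. x \<in> frontier \<Omega> \<Longrightarrow> u x = \<alpha> x"
    "smooth_on \<Omega> u" "has_laplacian u (\<lambda>x. 0) \<Omega>"
proof -
  let ?B = "frontier \<Omega>" and ?n = "real DIM('a)" and ?K = "closure \<Omega>"
  have com: "compact ?B" "bounded ?K"
    using assms(2) by (auto intro: compact_frontier_bounded bounded_closure)
  have Bcl: "?B \<subseteq> ?K" and \<Omega>cl: "\<Omega> \<subseteq> ?K" by (auto simp: frontier_def closure_subset)
  have cl_eq: "?K = \<Omega> \<union> ?B" by (simp add: closure_Un_frontier)
  have BO: "?B \<inter> \<Omega> = {}" using assms(1) by (simp add: frontier_def interior_open) blast
  have "\<Omega> \<noteq> UNIV" using assms(2) not_bounded_UNIV by blast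
  then obtain p0 where p0: "p0 \<in> ?B"
    using frontier_not_empty[OF assms(4)] by blast
  \<comment> \<open>One bound on all distances in the closure lets a strip of width \<open>d\<close>
    at any boundary point contain the whole region.\<close>
  obtain d where d: "d \<ge> 0" "\<And>x y. x \<in> ?K \<Longrightarrow> y \<in> ?K \<Longrightarrow> norm (x - y) \<le> d"
  proof (rule that)
    show "diameter ?K \<ge> 0" by (rule diameter_ge_0[OF com(2)])
    show "norm (x - y) \<le> diameter ?K" if "x \<in> ?K" "y \<in> ?K" for x y
      using diameter_bounded_bound[OF com(2) that] by (simp add: dist_norm)
  qed
  obtain c where c: "\<And>p. p \<in> ?B \<Longrightarrow> norm (c p) = 1"
    "\<And>p x. p \<in> ?B \<Longrightarrow> x \<in> ?K \<Longrightarrow> 0 \<le> c p \<bullet> (x - p)"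
    using convex_supporting_normals[OF assms(3,1)] by blast
  define b where "b = (\<lambda>p. barrier p (c p) d)"
  define L where "L = 2 * d + ?n * d"
  have L0: "L \<ge> 0" using d(1) by (simp add: L_def)
  have bL: "\<bar>b p x - b p y\<bar> \<le> L * norm (x - y)" if "p \<in> ?B" "x \<in> ?K" "y \<in> ?K" for p x y
    unfolding b_def L_def using that Bcl by (intro barrier_lipschitz c d) auto
  have b_ge: "(norm (x - p))\<^sup>2 \<le> b p x" if p: "p \<in> ?B" and x: "x \<in> ?K" for p x
  proof -
    have "norm (x - p) \<le> d" using d(2) x p Bcl by blast
    then have "c p \<bullet> (x - p) \<le> d"
      using Cauchy_Schwarz_ineq2[of "c p" "x - p"] c(1)[OF p] by simp
    then show ?thesis unfolding b_def using c(2)[OF p x] by (intro barrier_ge)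
  qed
  have b_self: "b p p = 0" for p by (simp add: b_def)
  have bharm: "has_laplacian (\<lambda>x. A + C * b p x) (\<lambda>x. 0) T" "continuous_on T (\<lambda>x. A + C * b p x)"
    if "p \<in> ?B" for p A C T
  proof -
    have "has_laplacian (\<lambda>x. A + C * b p x) (\<lambda>x. 0 + C * 0) T"
      unfolding b_def by (intro has_laplacian_add has_laplacian_const has_laplacian_cmult has_laplacian_barrier c that)
    then show "has_laplacian (\<lambda>x. A + C * b p x) (\<lambda>x. 0) T" by simp
    show "continuous_on T (\<lambda>x. A + C * b p x)" unfolding b_def by (intro continuous_intros)
  qed
  \<comment> \<open>Choice turns the constant of the quadratic modulus into a function of
    \<open>e\<close> alone, the same for every boundary point.\<close>
  define C where "C = (\<lambda>e. SOME C. C \<ge> 0 \<and> (\<forall>p\<in>?B. \<forall>x\<in>?B. \<bar>\<alpha> x - \<alpha> p\<bar> \<le> e + C * (norm (x - p))\<^sup>2))"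
  have C: "C e \<ge> 0" "\<And>p x. p \<in> ?B \<Longrightarrow> x \<in> ?B \<Longrightarrow> \<bar>\<alpha> x - \<alpha> p\<bar> \<le> e + C e * b p x" if "e > 0" for e
  proof -
    have "\<exists>C. C \<ge> 0 \<and> (\<forall>p\<in>?B. \<forall>x\<in>?B. \<bar>\<alpha> x - \<alpha> p\<bar> \<le> e + C * (norm (x - p))\<^sup>2)"
      using continuous_quadratic_modulus[OF com(1) \<alpha> that] by metis
    from someI_ex[OF this] have *: "C e \<ge> 0"
      "\<And>p x. p \<in> ?B \<Longrightarrow> x \<in> ?B \<Longrightarrow> \<bar>\<alpha> x - \<alpha> p\<bar> \<le> e + C e * (norm (x - p))\<^sup>2"
      unfolding C_def by auto
    show "C e \<ge> 0" by fact
    fix p x assume px: "p \<in> ?B" "x \<in> ?B"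
    have "C e * (norm (x - p))\<^sup>2 \<le> C e * b p x"
      using b_ge[of p x] px Bcl * by (intro mult_left_mono) auto
    then show "\<bar>\<alpha> x - \<alpha> p\<bar> \<le> e + C e * b p x" using *(2)[OF px] by simp
  qed

  \<comment> \<open>Continuity on the closed region belongs to the class, so each function built
    below has to be shown continuous on \<open>?K\<close> before it counts as a competitor.\<close>
  define S where "S = {v. continuous_on ?K v \<and> subharmonic \<Omega> v \<and> (\<forall>p\<in>?B. v p \<le> \<alpha> p)}"
  \<comment> \<open>The upper barriers both bound the supremum and control translated competitors at
    boundary points.\<close>
  have upper: "v x \<le> \<alpha> p + e + C e * b p x" if v: "v \<in> S" and p: "p \<in> ?B" and x: "x \<in> ?K" and e: "e > 0"
    for v p x e
  proof -
    have B: "v y \<le> \<alpha> p + e + C e * b p y" if "y \<in> ?B" for y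
      using C(2)[OF e p that] v that by (auto simp: S_def)
    have "v y \<le> \<alpha> p + e + C e * b p y" if "y \<in> \<Omega>" for y
      by (rule subharmonicD[OF _ assms(1) order_refl bharm(2)[OF p] bharm(1)[OF p] B that])
         (use v in \<open>auto simp: S_def\<close>)
    then show ?thesis using x B unfolding cl_eq by blast
  qed

  \<comment> \<open>The supremum of all lower barriers is a single competitor within
    \<open>e\<close> of the data at every boundary point; an individual barrier is guaranteed this
    only at its own point.\<close>
  define v0 where "v0 = (\<lambda>e x. SUP v\<in>(\<lambda>p x. \<alpha> p - e + (- C e) * b p x) ` ?B. v x)"
  have v0: "v0 e \<in> S" "\<And>p x. p \<in> ?B \<Longrightarrow> x \<in> ?K \<Longrightarrow> \<alpha> p - e - C e * b p x \<le> v0 e x" if e: "e > 0" for e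
  proof -
    let ?F = "(\<lambda>p x. \<alpha> p - e + (- C e) * b p x) ` ?B"
    have ne: "?F \<noteq> {}" using p0 by blast
    have "bounded (\<alpha> ` ?B)" by (intro compact_imp_bounded compact_continuous_image \<alpha> com)
    then obtain A where A: "\<And>p. p \<in> ?B \<Longrightarrow> \<bar>\<alpha> p\<bar> \<le> A" unfolding bounded_iff by auto
    have nonneg: "C e * b p x \<ge> 0" if "p \<in> ?B" "x \<in> ?K" for p x
      using C(1)[OF e] b_ge[OF that] by (intro mult_nonneg_nonneg) (auto intro: order_trans[OF zero_le_power2])
    have bdd: "bdd_above ((\<lambda>v. v x) ` ?F)" if "x \<in> ?K" for x
    proof (rule bdd_aboveI)
      fix z assume "z \<in> (\<lambda>v. v x) ` ?F"
      then obtain p where p: "p \<in> ?B" "z = \<alpha> p - e + (- C e) * b p x" by blast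
      then show "z \<le> A" using A[OF p(1)] nonneg[OF p(1) that] e by auto
    qed
    show low: "\<alpha> p - e - C e * b p x \<le> v0 e x" if "p \<in> ?B" "x \<in> ?K" for p x
    proof -
      have "(\<lambda>v. v x) (\<lambda>x. \<alpha> p - e + (- C e) * b p x) \<le> v0 e x"
        unfolding v0_def by (intro cSUP_upper bdd that imageI)
      then show ?thesis by simp
    qed
    have "continuous_on ?K (v0 e)"
      unfolding v0_def
    proof (rule continuous_on_SUP_equicontinuous[OF ne])
      fix \<epsilon> :: real assume \<epsilon>: "\<epsilon> > 0"
      \<comment> \<open>The added 1 avoids division by zero when \<open>C e * L\<close>
        vanishes.\<close>
      define \<delta> where "\<delta> = \<epsilon> / (C e * L + 1)"
      have pos: "C e * L + 1 > 0" using C(1)[OF e] L0 by (simp add: add_nonneg_pos)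
      show "\<exists>\<delta>>0. \<forall>v\<in>?F. \<forall>x\<in>?K. \<forall>y\<in>?K. dist x y < \<delta> \<longrightarrow> v y \<le> (SUP w\<in>?F. w x) + \<epsilon>"
      proof (intro exI[of _ \<delta>] conjI ballI impI)
        show "\<delta> > 0" using \<epsilon> pos by (simp add: \<delta>_def)
        fix v x y assume v: "v \<in> ?F" and xy: "x \<in> ?K" "y \<in> ?K" "dist x y < \<delta>"
        obtain p where p: "p \<in> ?B" "v = (\<lambda>x. \<alpha> p - e + (- C e) * b p x)" using v by blast
        have "b p x - b p y \<le> L * norm (x - y)" using bL[OF p(1) xy(1,2)] by simp
        then have "C e * (b p x - b p y) \<le> C e * (L * norm (x - y))"
          using C(1)[OF e] by (rule mult_left_mono)
        also have "\<dots> \<le> (C e * L + 1) * norm (x - y)" by (simp add: algebra_simps)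
        also have "\<dots> \<le> (C e * L + 1) * \<delta>" using xy(3) pos by (intro mult_left_mono) (auto simp: dist_norm)
        also have "\<dots> = \<epsilon>" using pos by (simp add: \<delta>_def)
        finally have "v y \<le> \<alpha> p - e - C e * b p x + \<epsilon>" unfolding p(2) by (simp add: algebra_simps)
        also have "\<dots> \<le> v0 e x + \<epsilon>" using low[OF p(1) xy(1)] by simp
        finally show "v y \<le> (SUP w\<in>?F. w x) + \<epsilon>" unfolding v0_def .
      qed
    qed
    moreover have "subharmonic \<Omega> (v0 e)"
      unfolding v0_def
    proof (rule subharmonic_SUP[OF ne _ bdd])
      fix v assume "v \<in> ?F"
      then obtain p where p: "p \<in> ?B" "v = (\<lambda>x. \<alpha> p - e + (- C e) * b p x)" by blast
      show "subharmonic \<Omega> v"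
        unfolding p(2) by (intro harmonic_imp_subharmonic assms bharm p)
    qed
    moreover have "v0 e q \<le> \<alpha> q" if q: "q \<in> ?B" for q
      unfolding v0_def
    proof (rule cSUP_least[OF ne])
      fix v assume "v \<in> ?F"
      then obtain p where p: "p \<in> ?B" "v = (\<lambda>x. \<alpha> p - e + (- C e) * b p x)" by blast
      show "v q \<le> \<alpha> q" unfolding p(2) using C(2)[OF e p(1) q] by simp
    qed
    ultimately show "v0 e \<in> S" by (simp add: S_def)
  qed

  define u where "u = (\<lambda>x. SUP v\<in>S. v x)"
  have S_ne: "S \<noteq> {}" using v0(1)[of 1] by auto
  have bdd: "bdd_above ((\<lambda>v. v x) ` S)" if "x \<in> ?K" for x
    by (rule bdd_aboveI[of _ "\<alpha> p0 + 1 + C 1 * b p0 x"]) (use upper[OF _ p0 that, of _ 1] in auto)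
  have u_upper: "v x \<le> u x" if "v \<in> S" "x \<in> ?K" for v x
    unfolding u_def using that bdd by (intro cSUP_upper)
  have uB: "u p = \<alpha> p" if p: "p \<in> ?B" for p
  proof (rule antisym)
    show "u p \<le> \<alpha> p"
      unfolding u_def using p S_ne by (intro cSUP_least) (auto simp: S_def)
    show "\<alpha> p \<le> u p"
    proof (rule field_le_epsilon)
      fix e :: real assume e: "e > 0"
      have "\<alpha> p - e \<le> v0 e p" using v0(2)[OF e p, of p] p Bcl by (auto simp: b_self)
      also have "\<dots> \<le> u p" using v0(1)[OF e] p Bcl by (intro u_upper) auto
      finally show "\<alpha> p \<le> u p + e" by simp
    qed
  qed
  have "continuous_on ?K u"
    unfolding u_def
  proof (rule continuous_on_SUP_equicontinuous[OF S_ne])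
    fix \<epsilon> :: real assume \<epsilon>: "\<epsilon> > 0"
    \<comment> \<open>One \<open>e\<close> pays for the modulus of the data and one for the barrier
      term, so lowering by \<open>\<epsilon> = 3 * e\<close> leaves room in both comparisons
      below.\<close>
    define e where "e = \<epsilon> / 3"
    have e: "e > 0" using \<epsilon> by (simp add: e_def)
    have pos: "C e * L + 1 > 0" using C(1)[OF e] L0 by (simp add: add_nonneg_pos)
    define \<delta> where "\<delta> = e / (C e * L + 1)"
    have small: "C e * b p x \<le> e" if "p \<in> ?B" "x \<in> ?K" "norm (x - p) < \<delta>" for p x
    proof -
      have "b p x \<le> L * norm (x - p)" using bL[of p x p] that Bcl by (auto simp: b_self)
      then have "C e * b p x \<le> C e * (L * norm (x - p))" using C(1)[OF e] by (rule mult_left_mono)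
      also have "\<dots> \<le> (C e * L + 1) * norm (x - p)" by (simp add: algebra_simps)
      also have "\<dots> \<le> (C e * L + 1) * \<delta>" using that(3) pos by (intro mult_left_mono) auto
      also have "\<dots> = e" using pos by (simp add: \<delta>_def)
      finally show ?thesis .
    qed
    (* The translate of v, lowered by \<epsilon>, lies below the boundary values wherever it is glued to v,
       so the glued function is again a competitor. *)
    have "v y \<le> u x + \<epsilon>" if v: "v \<in> S" and xy: "x \<in> ?K" "y \<in> ?K" "dist x y < \<delta>" for v x y
    proof -
      define z where "z = y - x"
      have z: "norm z < \<delta>" using xy(3) by (simp add: z_def dist_norm norm_minus_commute)
      define E where "E = {x. x + z \<in> \<Omega>}"
      have E: "E = (\<lambda>x. - z + x) ` \<Omega>" unfolding E_def translation_image by simp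
      have oE: "open E" unfolding E by (rule open_translation[OF assms(1)])
      have clE: "closure E = {x. x + z \<in> ?K}"
        unfolding E closure_translation translation_image by simp
      have frE: "frontier E = {x. x + z \<in> ?B}"
        unfolding E frontier_translation translation_image by simp
      \<comment> \<open>\<open>v\<close> may lie far below the data near the boundary. Raising it to
        \<open>v0 e\<close> makes it at least the lowered translate \<open>w\<close> on the part of
        \<open>frontier E\<close> where the two are glued.\<close>
      define v1 where "v1 = (\<lambda>x. max (v x) (v0 e x))"
      define w where "w = (\<lambda>x. v (x + z) - \<epsilon>)"
      define v' where "v' = (\<lambda>x. if x \<in> closure E then max (v1 x) (w x) else v1 x)"
      have v1: "subharmonic \<Omega> v1" "continuous_on ?K v1" "\<And>p. p \<in> ?B \<Longrightarrow> v1 p \<le> \<alpha> p"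
        using v v0(1)[OF e] unfolding v1_def S_def
        by (auto intro!: subharmonic_max continuous_intros)
      have wc: "continuous_on {x. x + z \<in> ?K} w"
      proof -
        have "continuous_on ?K v" using v by (simp add: S_def)
        then have "continuous_on {x. x + z \<in> ?K} (\<lambda>x. v (x + z))"
          by (rule continuous_on_compose2) (auto intro!: continuous_intros)
        then show ?thesis unfolding w_def by (intro continuous_on_diff continuous_on_const)
      qed
      \<comment> \<open>Here \<open>t + z\<close> is a boundary point, so \<open>v\<close> is at
        most \<open>\<alpha>\<close> there, and the lower barrier at this nearby point keeps
        \<open>v0 e t\<close> from falling much below the same value.\<close>
      have wv1: "w t \<le> v1 t" if t: "t \<in> frontier E" "t \<in> ?K" for t
      proof -
        have p: "t + z \<in> ?B" using t frE by simp
        have "w t \<le> \<alpha> (t + z) - \<epsilon>" using v p by (auto simp: w_def S_def)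
        also have "\<dots> \<le> \<alpha> (t + z) - e - C e * b (t + z) t"
          using small[OF p t(2)] z e by (simp add: e_def)
        also have "\<dots> \<le> v1 t" using v0(2)[OF e p t(2)] by (simp add: v1_def)
        finally show ?thesis .
      qed
      have "v' \<in> S"
        unfolding S_def
      proof (intro CollectI conjI ballI)
        show "subharmonic \<Omega> v'"
          unfolding v'_def
        proof (rule subharmonic_glue[OF v1(1) _ oE])
          show "subharmonic E w"
            unfolding E_def w_def using v by (intro subharmonic_translate) (simp add: S_def)
          show "w t \<le> v1 t" if "t \<in> frontier E" "t \<in> \<Omega>" for t
            using wv1 that \<Omega>cl by blast
        qed
        have "continuous_on ((?K \<inter> closure E) \<union> (?K - E)) v'"
          unfolding v'_def
        proof (rule continuous_on_cases)
          show "closed (?K \<inter> closure E)" by (intro closed_Int closed_closure)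
          show "closed (?K - E)" by (intro closed_Diff closed_closure oE)
          show "continuous_on (?K \<inter> closure E) (\<lambda>x. max (v1 x) (w x))"
            by (intro continuous_on_max continuous_on_subset[OF v1(2)] continuous_on_subset[OF wc])
               (auto simp: clE)
          show "continuous_on (?K - E) v1" by (rule continuous_on_subset[OF v1(2)]) auto
          show "\<forall>x. x \<in> ?K \<inter> closure E \<and> x \<notin> closure E \<or> x \<in> ?K - E \<and> x \<in> closure E \<longrightarrow>
              max (v1 x) (w x) = v1 x"
          proof (intro allI impI)
            fix t assume "t \<in> ?K \<inter> closure E \<and> t \<notin> closure E \<or> t \<in> ?K - E \<and> t \<in> closure E"
            then have "t \<in> frontier E" "t \<in> ?K" using oE by (auto simp: frontier_def interior_open)
            then show "max (v1 t) (w t) = v1 t" using wv1 by (simp add: max_absorb1)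
          qed
        qed
        moreover have "(?K \<inter> closure E) \<union> (?K - E) = ?K" using closure_subset[of E] by blast
        ultimately show "continuous_on ?K v'" by simp
        fix p assume p: "p \<in> ?B"
        show "v' p \<le> \<alpha> p"
        proof (cases "p \<in> closure E")
          case True
          then have pz: "p + z \<in> ?K" by (simp add: clE)
          have "w p \<le> \<alpha> p + e + C e * b p (p + z) - \<epsilon>"
            using upper[OF v p pz e] by (simp add: w_def)
          also have "\<dots> \<le> \<alpha> p" using small[OF p pz] z e by (simp add: e_def)
          finally show ?thesis using v1(3)[OF p] by (simp add: v'_def)
        qed (use v1(3)[OF p] in \<open>simp add: v'_def\<close>)
      qed
      \<comment> \<open>Since \<open>x + z = y\<close>, the value of the competitor
        \<open>v'\<close> at \<open>x\<close> is at least \<open>v y - \<epsilon>\<close>.\<close>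
      then have "v' x \<le> u x" by (rule u_upper[OF _ xy(1)])
      moreover have "x \<in> closure E" using xy(2) by (simp add: clE z_def)
      then have "v y - \<epsilon> \<le> v' x" by (simp add: v'_def w_def z_def)
      ultimately show ?thesis by simp
    qed
    moreover have "\<delta> > 0" using e pos by (simp add: \<delta>_def)
    ultimately show "\<exists>\<delta>>0. \<forall>v\<in>S. \<forall>x\<in>?K. \<forall>y\<in>?K. dist x y < \<delta> \<longrightarrow> v y \<le> (SUP w\<in>S. w x) + \<epsilon>"
      unfolding u_def by blast
  qed
  note u_cont = this
  have u_sub: "subharmonic \<Omega> u"
    unfolding u_def by (rule subharmonic_SUP[OF S_ne _ bdd]) (simp_all add: S_def)

  \<comment> \<open>Continuity of \<open>u\<close> on the sphere provides a harmonic
    \<open>h\<close> with the same values. Replacing \<open>u\<close> by \<open>h\<close> in the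
    ball gives a member of \<open>S\<close>, whence \<open>h \<le> u\<close>; the reverse inequality
    is subharmonicity of \<open>u\<close>.\<close>
  have local: "\<exists>r>0. \<exists>h. smooth_on (ball a r) h \<and> has_laplacian h (\<lambda>x. 0) (ball a r) \<and> (\<forall>x\<in>ball a r. h x = u x)"
    if a: "a \<in> \<Omega>" for a
  proof -
    obtain r where r: "r > 0" "cball a r \<subseteq> \<Omega>" using a assms(1) by (meson open_contains_cball)
    have "continuous_on (sphere a r) u"
      by (rule continuous_on_subset[OF u_cont]) (use r(2) \<Omega>cl in auto)
    then obtain h where h: "continuous_on (cball a r) h" "\<And>x. x \<in> sphere a r \<Longrightarrow> h x = u x"
      "smooth_on (ball a r) h" "has_laplacian h (\<lambda>x. 0) (ball a r)"
      using dirichlet_ball[OF r(1)] by blast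
    define u' where "u' = (\<lambda>x. if x \<in> ball a r then h x else u x)"
    note lift = subharmonic_lift[OF u_sub r(2,1) h(1,4,2)]
    have "u' \<in> S"
      unfolding S_def
    proof (intro CollectI conjI ballI)
      show "subharmonic \<Omega> u'" unfolding u'_def by (rule lift(2))
      show "u' p \<le> \<alpha> p" if "p \<in> ?B" for p
        using uB[OF that] that BO r(2) by (force simp: u'_def)
      have "continuous_on (cball a r \<union> (?K - ball a r)) u'"
        unfolding u'_def
      proof (rule continuous_on_cases)
        show "closed (?K - ball a r)" by (intro closed_Diff closed_closure open_ball)
        show "continuous_on (?K - ball a r) u" by (rule continuous_on_subset[OF u_cont]) auto
        show "\<forall>x. x \<in> cball a r \<and> x \<notin> ball a r \<or> x \<in> ?K - ball a r \<and> x \<in> ball a r \<longrightarrow> h x = u x"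
          using h(2) by auto
      qed (use h(1) in auto)
      moreover have "cball a r \<union> (?K - ball a r) = ?K" using r(2) \<Omega>cl by auto
      ultimately show "continuous_on ?K u'" by simp
    qed
    have "h x \<le> u x" if "x \<in> ball a r" for x
    proof -
      have "ball a r \<subseteq> cball a r" by auto
      then have "x \<in> ?K" using that r(2) \<Omega>cl by blast
      then show ?thesis using u_upper[OF \<open>u' \<in> S\<close>, of x] that by (simp add: u'_def)
    qed
    then have "h x = u x" if "x \<in> ball a r" for x
    using lift(1)[OF _ that] that by (simp add: antisym)
    then show ?thesis using r(1) h(3,4) by blast
  qed
  have "Ck_on k \<Omega> u" for k
  proof (rule Ck_on_local)
    fix a assume "a \<in> \<Omega>"
    then obtain r h where "r > 0" "smooth_on (ball a r) h" "\<And>x. x \<in> ball a r \<Longrightarrow> h x = u x"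
      using local by meson
    then have "Ck_on k (ball a r) u"
      unfolding smooth_on_def by (intro Ck_on_cong[of "ball a r" h u]) auto
    then show "\<exists>T. open T \<and> a \<in> T \<and> Ck_on k T u" using \<open>r > 0\<close> by (intro exI[of _ "ball a r"]) auto
  qed
  then have "smooth_on \<Omega> u" by (simp add: smooth_on_def)
  moreover have "has_laplacian u (\<lambda>x. 0) \<Omega>"
  proof (rule has_laplacian_local[OF assms(1)])
    fix a assume "a \<in> \<Omega>"
    then obtain r h where r: "r > 0" "has_laplacian h (\<lambda>x. 0) (ball a r)" "\<And>x. x \<in> ball a r \<Longrightarrow> h x = u x"
      using local by meson
    have "has_laplacian u (\<lambda>x. 0) (ball a r)" by (rule has_laplacian_cong[OF open_ball r(3,2)])
    then show "\<exists>T. open T \<and> a \<in> T \<and> has_laplacian u (\<lambda>x. 0) T"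
      using \<open>r > 0\<close> by (intro exI[of _ "ball a r"]) auto
  qed
  ultimately show ?thesis using that u_cont uB by blast
qed

section \<open>The vector-valued Dirichlet problem\<close>

text \<open>By the induction hypothesis the coefficients of a Cauchy sequence of combinations of
  \<open>S\<close> converge, so a limit of such combinations is again one. Hence the new vector
  \<open>t\<close> has positive distance \<open>d\<close> from \<open>span S\<close>, which bounds
  its coefficient.\<close>

lemma independent_coefficients_bounded:
  fixes S :: "'v::real_normed_vector set"
  assumes "finite S" "independent S"
  shows "\<exists>K\<ge>0. \<forall>a. \<forall>s\<in>S. \<bar>a s\<bar> \<le> K * norm (\<Sum>s\<in>S. a s *\<^sub>R s)"
  using assms
proof (induction S)
  case empty
  then show ?case by auto
next
  case (insert t S)
  have ind: "independent S" and t: "t \<notin> span S"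
    using insert.prems insert.hyps by (auto simp: independent_insert)
  obtain K where K: "K \<ge> 0" "\<And>a s. s \<in> S \<Longrightarrow> \<bar>a s\<bar> \<le> K * norm (\<Sum>s\<in>S. a s *\<^sub>R s)"
    using insert.IH[OF ind] by blast
  have "\<exists>d>0. \<forall>a. d \<le> norm (t - (\<Sum>s\<in>S. a s *\<^sub>R s))"
  proof (rule ccontr)
    assume neg: "\<not> (\<exists>d>0. \<forall>a. d \<le> norm (t - (\<Sum>s\<in>S. a s *\<^sub>R s)))"
    have "\<exists>a. norm (t - (\<Sum>s\<in>S. a s *\<^sub>R s)) < d" if "d > 0" for d
      using neg that by (meson not_less)
    then have "\<exists>a. norm (t - (\<Sum>s\<in>S. a s *\<^sub>R s)) < inverse (real (Suc n))" for n
      by simp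
    then obtain a where a: "\<And>n. norm (t - (\<Sum>s\<in>S. a n s *\<^sub>R s)) < inverse (real (Suc n))"
      by metis
    define w where "w = (\<lambda>n. \<Sum>s\<in>S. a n s *\<^sub>R s)"
    have "(\<lambda>n. w n - t) \<longlonglongrightarrow> 0"
      by (rule Lim_null_comparison[OF _ LIMSEQ_inverse_real_of_nat])
         (use a in \<open>auto intro!: always_eventually less_imp_le simp: w_def norm_minus_commute\<close>)
    then have wt: "w \<longlonglongrightarrow> t" by (simp add: LIM_zero_iff)
    then have wC: "Cauchy w" by (rule LIMSEQ_imp_Cauchy)
    have "convergent (\<lambda>n. a n s)" if s: "s \<in> S" for s
    proof -
      have "Cauchy (\<lambda>n. a n s)"
      proof (rule CauchyI)
        fix e :: real assume "e > 0"
        have pos: "K + 1 > 0" using K by simp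
        then have "e / (K + 1) > 0" using \<open>e > 0\<close> by simp
        then obtain M where M: "\<And>m n. m \<ge> M \<Longrightarrow> n \<ge> M \<Longrightarrow> norm (w m - w n) < e / (K + 1)"
          using wC[THEN CauchyD] by blast
        have "norm (a m s - a n s) < e" if "m \<ge> M" "n \<ge> M" for m n
        proof -
          have "\<bar>a m s - a n s\<bar> \<le> K * norm (w m - w n)"
            using K(2)[OF s, of "\<lambda>s. a m s - a n s"]
            by (simp add: w_def scaleR_left_diff_distrib sum_subtractf)
          also have "\<dots> \<le> (K + 1) * norm (w m - w n)" by (simp add: algebra_simps)
          also have "\<dots> < (K + 1) * (e / (K + 1))"
            using M[OF that] pos by (intro mult_strict_left_mono)
          finally show ?thesis using pos by simp
        qed
        then show "\<exists>M. \<forall>m\<ge>M. \<forall>n\<ge>M. norm (a m s - a n s) < e" by blast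
      qed
      then show ?thesis by (simp add: Cauchy_convergent_iff)
    qed
    then have "\<exists>l. \<forall>s\<in>S. (\<lambda>n. a n s) \<longlonglongrightarrow> l s"
      unfolding convergent_def by (rule bchoice[OF ballI])
    then obtain l where "\<And>s. s \<in> S \<Longrightarrow> (\<lambda>n. a n s) \<longlonglongrightarrow> l s" by blast
    then have "w \<longlonglongrightarrow> (\<Sum>s\<in>S. l s *\<^sub>R s)"
      unfolding w_def by (intro tendsto_sum tendsto_scaleR tendsto_const)
    then have "t = (\<Sum>s\<in>S. l s *\<^sub>R s)" using wt LIMSEQ_unique by blast
    then show False using t by (auto intro: span_sum span_scale span_base)
  qed
  then obtain d where d: "d > 0" "\<And>a. d \<le> norm (t - (\<Sum>s\<in>S. a s *\<^sub>R s))" by blast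
  \<comment> \<open>The coefficient of \<open>t\<close> is at most \<open>norm x / d\<close>;
    removing its part of \<open>x\<close> leaves norm at most
    \<open>(1 + norm t / d) * norm x\<close>, to which \<open>K\<close> applies. \<open>K'\<close>
    adds both bounds.\<close>
  define K' where "K' = 1 / d + K * (1 + norm t / d)"
  have K'0: "1 / d \<ge> 0" "K * (1 + norm t / d) \<ge> 0" using K(1) d(1) by auto
  have "\<bar>a s\<bar> \<le> K' * norm (\<Sum>s\<in>insert t S. a s *\<^sub>R s)" if s: "s \<in> insert t S" for a s
  proof -
    define x where "x = (\<Sum>s\<in>insert t S. a s *\<^sub>R s)"
    have x: "x = a t *\<^sub>R t + (\<Sum>s\<in>S. a s *\<^sub>R s)" using insert.hyps by (simp add: x_def)
    have at: "\<bar>a t\<bar> \<le> norm x / d"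
    proof (cases "a t = 0")
      case False
      have "x = a t *\<^sub>R (t - (\<Sum>s\<in>S. (- a s / a t) *\<^sub>R s))"
        using False by (simp add: x scaleR_diff_right scaleR_add_right scaleR_sum_right sum_negf)
      then have "norm x = \<bar>a t\<bar> * norm (t - (\<Sum>s\<in>S. (- a s / a t) *\<^sub>R s))" by simp
      also have "\<dots> \<ge> \<bar>a t\<bar> * d" by (intro mult_left_mono d) auto
      finally show ?thesis using d(1) by (simp add: field_simps)
    qed (use d in simp)
    show ?thesis
    proof (cases "s = t")
      case True
      have "\<bar>a t\<bar> \<le> 1 / d * norm x" using at by simp
      also have "\<dots> \<le> K' * norm x" unfolding K'_def using K'0 by (intro mult_right_mono) auto
      finally show ?thesis using True by (simp add: x_def)
    next
      case False
      then have "\<bar>a s\<bar> \<le> K * norm (\<Sum>s\<in>S. a s *\<^sub>R s)" using K(2) s by blast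
      also have "(\<Sum>s\<in>S. a s *\<^sub>R s) = x - a t *\<^sub>R t" by (simp add: x)
      also have "norm (x - a t *\<^sub>R t) \<le> norm x + \<bar>a t\<bar> * norm t"
        using norm_triangle_ineq4[of x "a t *\<^sub>R t"] by simp
      also have "\<bar>a t\<bar> * norm t \<le> norm x / d * norm t" by (rule mult_right_mono[OF at]) simp
      finally have "\<bar>a s\<bar> \<le> K * (norm x + norm x / d * norm t)" using K(1) by (simp add: mult_left_mono)
      also have "\<dots> = K * (1 + norm t / d) * norm x" by (simp add: algebra_simps)
      also have "\<dots> \<le> K' * norm x" unfolding K'_def using K'0 by (intro mult_right_mono) auto
      finally show ?thesis by (simp add: x_def)
    qed
  qed
  moreover have "K' \<ge> 0" using K'0 by (simp add: K'_def)
  ultimately show ?case by blast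
qed

lemma finite_span_coordinates:
  fixes S :: "'v::real_normed_vector set"
  assumes "finite S" "span S = UNIV"
  obtains B :: "'v set" and L where "finite B" "\<And>b. b \<in> B \<Longrightarrow> bounded_linear (L b)"
    "\<And>v. v = (\<Sum>b\<in>B. L b v *\<^sub>R b)" "\<And>a b. b \<in> B \<Longrightarrow> L b (\<Sum>c\<in>B. a c *\<^sub>R c) = a b"
proof -
  obtain B where B: "B \<subseteq> S" "independent B" "S \<subseteq> span B"
    using maximal_independent_subset[of S] by blast
  have fin: "finite B" using B assms finite_subset by blast
  have span: "span B = UNIV"
    using span_mono[OF B(3)] assms(2) by (simp add: span_span top.extremum_unique)
  define L where "L = (\<lambda>b v. representation B v b)"
  have sum: "v = (\<Sum>b\<in>B. L b v *\<^sub>R b)" for v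
    unfolding L_def by (rule sum_representation_eq[symmetric, OF B(2) _ fin order_refl]) (simp add: span)
  obtain K where K: "K \<ge> 0" "\<And>a s. s \<in> B \<Longrightarrow> \<bar>a s\<bar> \<le> K * norm (\<Sum>s\<in>B. a s *\<^sub>R s)"
    using independent_coefficients_bounded[OF fin B(2)] by blast
  show ?thesis
  proof (rule that[OF fin _ sum])
    fix b assume b: "b \<in> B"
    show "bounded_linear (L b)"
    proof (rule bounded_linear_intro)
      show "L b (x + y) = L b x + L b y" for x y
        unfolding L_def by (simp add: representation_add[OF B(2)] span)
      show "L b (r *\<^sub>R x) = r *\<^sub>R L b x" for r x
        unfolding L_def by (simp add: representation_scale[OF B(2)] span)
      show "norm (L b x) \<le> norm x * K" for x
        using K(2)[OF b, of "\<lambda>b. L b x"] sum[of x] by (simp add: mult.commute)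
    qed
    fix a
    \<comment> \<open>The same bound, applied to a combination equal to zero, gives uniqueness of
      the coefficients.\<close>
    have "\<bar>L b (\<Sum>c\<in>B. a c *\<^sub>R c) - a b\<bar> \<le>
        K * norm (\<Sum>c\<in>B. (L c (\<Sum>c\<in>B. a c *\<^sub>R c) - a c) *\<^sub>R c)"
      by (rule K(2)[OF b, of "\<lambda>b. L b (\<Sum>c\<in>B. a c *\<^sub>R c) - a b"])
    also have "(\<Sum>c\<in>B. (L c (\<Sum>c\<in>B. a c *\<^sub>R c) - a c) *\<^sub>R c) = 0"
      using sum[of "\<Sum>c\<in>B. a c *\<^sub>R c"] by (simp add: scaleR_left_diff_distrib sum_subtractf)
    finally show "L b (\<Sum>c\<in>B. a c *\<^sub>R c) = a b" by simp
  qed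
qed

section \<open>Passage between vector-valued functions and their coordinates\<close>

lemma Ck_on_const: "Ck_on k S (\<lambda>x. c)"
  by (induction k arbitrary: c) (auto simp: frechet_derivative_const)

lemma Ck_on_sum:
  assumes "open S" "finite I" "\<And>i. i \<in> I \<Longrightarrow> Ck_on k S (f i)"
  shows "Ck_on k S (\<lambda>x. \<Sum>i\<in>I. f i x)"
  using assms(2,3) by (induction I) (auto intro: Ck_on_const Ck_on_add[OF assms(1)])

text \<open>Near each point of \<open>B\<close>, \<open>\<alpha>\<close> agrees on \<open>B\<close>
  with a function continuous on a full neighbourhood.\<close>

lemma smooth_on_hypersurface_continuous:
  assumes "smooth_on_hypersurface B \<alpha>"
  shows "continuous_on B \<alpha>"
  unfolding continuous_on_eq_continuous_within
proof
  fix p assume p: "p \<in> B"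
  have "\<exists>W g. open W \<and> p \<in> W \<and> smooth_on W g \<and> (\<forall>x\<in>B \<inter> W. g x = \<alpha> x)"
    using assms p unfolding smooth_on_hypersurface_def by (rule bspec)
  then obtain W g where W: "open W" "p \<in> W" "smooth_on W g" "\<forall>x\<in>B \<inter> W. g x = \<alpha> x"
    by (elim exE conjE) (rule that)
  have "Ck_on 0 W g" using W(3) unfolding smooth_on_def by blast
  then have "isCont g p" using W(1,2) by (simp add: continuous_on_eq_continuous_at)
  then have "continuous (at p within B) g" by (rule continuous_at_imp_continuous_at_within)
  moreover obtain e where e: "e > 0" "ball p e \<subseteq> W" using W(1,2) by (meson open_contains_ball)
  have "g x = \<alpha> x" if "x \<in> B" "dist x p < e" for x
    using W(4) e(2) that by (auto simp: dist_commute subset_iff)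
  ultimately show "continuous (at p within B) \<alpha>"
    by (rule continuous_transform_within[OF _ e(1) p])
qed

text \<open>Bounded functionals commute with differentiation, so the scalar theory applies to each
  coordinate.\<close>

lemma has_laplacian_bounded_linear:
  fixes f :: "'a::euclidean_space \<Rightarrow> 'v::real_normed_vector" and L :: "'v \<Rightarrow> real"
  assumes "open D" "bounded_linear L" "Ck_on 2 D f"
  shows "has_laplacian (\<lambda>x. L (f x))
    (\<lambda>x. L (\<Sum>b\<in>Basis. frechet_derivative (\<lambda>y. frechet_derivative f (at y) b) (at x) b)) D"
proof (rule has_laplacianI[where f' = "\<lambda>x v. L (frechet_derivative f (at x) v)" and
      f'' = "\<lambda>b x v. L (frechet_derivative (\<lambda>y. frechet_derivative f (at y) b) (at x) v)"])
  fix x assume x: "x \<in> D"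
  have d: "f differentiable (at x)" "(\<lambda>y. frechet_derivative f (at y) b) differentiable (at x)" for b
    using assms(3) x by (auto simp: numeral_2_eq_2)
  show "((\<lambda>x. L (f x)) has_derivative (\<lambda>v. L (frechet_derivative f (at x) v))) (at x)"
    using d(1) by (intro bounded_linear.has_derivative[OF assms(2)]) (simp add: frechet_derivative_works)
  show "((\<lambda>y. L (frechet_derivative f (at y) b)) has_derivative
      (\<lambda>v. L (frechet_derivative (\<lambda>y. frechet_derivative f (at y) b) (at x) v))) (at x)" for b
    using d(2) by (intro bounded_linear.has_derivative[OF assms(2)]) (simp add: frechet_derivative_works)
  show "L (\<Sum>b\<in>Basis. frechet_derivative (\<lambda>y. frechet_derivative f (at y) b) (at x) b) =
      (\<Sum>b\<in>Basis. L (frechet_derivative (\<lambda>y. frechet_derivative f (at y) b) (at x) b))"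
    by (rule linear_sum[OF bounded_linear.linear[OF assms(2)]])
qed

text \<open>A functional turns both solutions into scalar harmonic functions with equal boundary
  values, which are compared in both directions. The coordinate functionals together then separate
  vectors.\<close>

lemma dirichlet_solution_unique:
  fixes \<Phi> \<Psi> :: "'a::euclidean_space \<Rightarrow> 'v::real_normed_vector"
  assumes "compact B" "frontier (inside B) = B" and L: "bounded_linear (L :: 'v \<Rightarrow> real)"
    and sol: "dirichlet_solution B \<alpha> \<Phi>" "dirichlet_solution B \<alpha> \<Psi>" and x: "x \<in> B \<union> inside B"
  shows "L (\<Phi> x) = L (\<Psi> x)"
proof -
  have O: "open (inside B)" "bounded (inside B)"
    using assms(1) by (auto intro: open_inside bounded_inside compact_imp_closed compact_imp_bounded)
  have cl: "closure (inside B) = B \<union> inside B"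
    using closure_Un_frontier[of "inside B"] assms(2) by auto
  have H: "continuous_on (closure (inside B)) (\<lambda>x. L (F x))"
    "has_laplacian (\<lambda>x. L (F x)) (\<lambda>x. 0) (inside B)" if F: "dirichlet_solution B \<alpha> F" for F
  proof -
    show "continuous_on (closure (inside B)) (\<lambda>x. L (F x))"
      using F unfolding dirichlet_solution_def cl by (auto intro: bounded_linear.continuous_on[OF L])
    have C2: "Ck_on 2 (inside B) F"
      and z: "x \<in> inside B \<Longrightarrow>
        (\<Sum>b\<in>Basis. frechet_derivative (\<lambda>y. frechet_derivative F (at y) b) (at x) b) = 0" for x
      using F unfolding dirichlet_solution_def laplace_beltrami_zero_form by auto
    from has_laplacian_bounded_linear[OF O(1) L C2]
    show "has_laplacian (\<lambda>x. L (F x)) (\<lambda>x. 0) (inside B)"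
      unfolding has_laplacian_iff[OF O(1)] by (auto simp: z linear_0[OF bounded_linear.linear[OF L]])
  qed
  have eq: "L (\<Phi> y) = L (\<Psi> y)" if "y \<in> frontier (inside B)" for y
    using sol that assms(2) by (simp add: dirichlet_solution_def)
  have x': "x \<in> closure (inside B)" using x cl by simp
  show ?thesis
    by (rule antisym; rule harmonic_le[OF O H(1) H(1) H(2) H(2) _ x'])
       (use sol eq in auto)
qed

lemma dirichlet_solution_exists:
  fixes B :: "'a::euclidean_space set" and \<alpha> :: "'a \<Rightarrow> 'v::real_normed_vector"
  assumes B: "compact B" "inside B \<noteq> {}" "convex (inside B)" "frontier (inside B) = B"
    and S: "finite S" "span S = (UNIV :: 'v set)" and \<alpha>: "continuous_on B \<alpha>"
  shows "\<exists>!\<Phi>. dirichlet_solution B \<alpha> \<Phi> \<and> \<Phi> \<in> extensional (B \<union> inside B)"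
    and "\<exists>\<Phi>. dirichlet_solution B \<alpha> \<Phi> \<and> \<Phi> \<in> extensional (B \<union> inside B) \<and> smooth_on (inside B) \<Phi>"
proof -
  let ?O = "inside B" and ?K = "B \<union> inside B"
  have O: "open ?O" "bounded ?O"
    using B(1) by (auto intro: open_inside bounded_inside compact_imp_closed compact_imp_bounded)
  have cl: "closure ?O = ?K"
    using closure_Un_frontier[of "inside B"] B(4) by auto
  obtain E :: "'v set" and L where E: "finite E" "\<And>b. b \<in> E \<Longrightarrow> bounded_linear (L b)"
    "\<And>v. v = (\<Sum>b\<in>E. L b v *\<^sub>R b)" "\<And>a b. b \<in> E \<Longrightarrow> L b (\<Sum>c\<in>E. a c *\<^sub>R c) = a b"
    using finite_span_coordinates[OF S] by blast
  have "\<exists>u. continuous_on ?K u \<and> (\<forall>x\<in>B. u x = L b (\<alpha> x)) \<and> smooth_on ?O u \<and> has_laplacian u (\<lambda>x. 0) ?O"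
    if b: "b \<in> E" for b
  proof -
    have "continuous_on (frontier ?O) (\<lambda>x. L b (\<alpha> x))"
      unfolding B(4) by (rule bounded_linear.continuous_on[OF E(2)[OF b] \<alpha>])
    then obtain u where "continuous_on (closure ?O) u" "\<And>x. x \<in> frontier ?O \<Longrightarrow> u x = L b (\<alpha> x)"
      "smooth_on ?O u" "has_laplacian u (\<lambda>x. 0) ?O"
      using dirichlet_convex[OF O B(3,2)] by blast
    then show ?thesis unfolding cl B(4) by blast
  qed
  then have "\<exists>u. \<forall>b\<in>E. continuous_on ?K (u b) \<and> (\<forall>x\<in>B. u b x = L b (\<alpha> x)) \<and>
      smooth_on ?O (u b) \<and> has_laplacian (u b) (\<lambda>x. 0) ?O"
    by (intro bchoice ballI)
  then obtain u where u: "\<And>b. b \<in> E \<Longrightarrow> continuous_on ?K (u b)"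
    "\<And>b x. b \<in> E \<Longrightarrow> x \<in> B \<Longrightarrow> u b x = L b (\<alpha> x)"
    "\<And>b. b \<in> E \<Longrightarrow> smooth_on ?O (u b)" "\<And>b. b \<in> E \<Longrightarrow> has_laplacian (u b) (\<lambda>x. 0) ?O"
    by blast
  define \<Phi>0 where "\<Phi>0 = (\<lambda>x. \<Sum>b\<in>E. u b x *\<^sub>R b)"
  \<comment> \<open>The restriction normalises values outside the closed region and leaves those on
    the open interior alone, so derivatives there are unaffected.\<close>
  define \<Phi> where "\<Phi> = restrict \<Phi>0 ?K"
  have eq: "\<Phi>0 x = \<Phi> x" if "x \<in> ?K" for x using that by (simp add: \<Phi>_def)
  have Ck: "Ck_on k ?O \<Phi>" for k
  proof (rule Ck_on_cong[OF O(1), of \<Phi>0])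
    show "Ck_on k ?O \<Phi>0"
      unfolding \<Phi>0_def
    proof (rule Ck_on_sum[OF O(1) E(1)])
      show "Ck_on k ?O (\<lambda>x. u b x *\<^sub>R b)" if "b \<in> E" for b
        using u(3)[OF that] unfolding smooth_on_def
        by (intro Ck_on_bounded_linear[OF O(1) bounded_linear_scaleR_left]) blast
    qed
  qed (use eq in simp)
  have sol: "dirichlet_solution B \<alpha> \<Phi>"
    unfolding dirichlet_solution_def laplace_beltrami_zero_form
  proof (intro conjI ballI)
    have "continuous_on ?K \<Phi>0" unfolding \<Phi>0_def by (intro continuous_intros u)
    then show "continuous_on ?K \<Phi>" by (rule continuous_on_eq) (rule eq)
    show "Ck_on 2 ?O \<Phi>" by (rule Ck)
    show "\<Phi> x = \<alpha> x" if x: "x \<in> B" for x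
    proof -
      have "\<Phi> x = (\<Sum>b\<in>E. L b (\<alpha> x) *\<^sub>R b)" using eq[of x] x u(2) by (simp add: \<Phi>0_def)
      then show ?thesis using E(3)[of "\<alpha> x"] by simp
    qed
    fix x assume x: "x \<in> ?O"
    let ?l = "\<lambda>x. \<Sum>b\<in>Basis. frechet_derivative (\<lambda>y. frechet_derivative \<Phi> (at y) b) (at x) b"
    \<comment> \<open>Both 0 and \<open>L b (?l x)\<close> are Laplacians of the coordinate
      \<open>u b\<close>, hence equal; a vector all of whose coordinates vanish is zero.\<close>
    have "L b (?l x) = 0" if b: "b \<in> E" for b
    proof -
      have "L b (\<Phi> y) = u b y" if "y \<in> ?O" for y
        using E(4)[OF b, of "\<lambda>b. u b y"] eq[of y] that by (simp add: \<Phi>0_def)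
      then have "has_laplacian (u b) (\<lambda>x. L b (?l x)) ?O"
        by (rule has_laplacian_cong[OF O(1) _ has_laplacian_bounded_linear[OF O(1) E(2)[OF b] Ck]])
      with u(4)[OF b] show ?thesis
        using x unfolding has_laplacian_iff[OF O(1)] by simp
    qed
    then have "?l x = 0" using E(3)[of "?l x"] by simp
    then show "- ?l x = 0" by simp
  qed
  have ext: "\<Phi> \<in> extensional ?K" by (simp add: \<Phi>_def)
  show "\<exists>\<Phi>. dirichlet_solution B \<alpha> \<Phi> \<and> \<Phi> \<in> extensional ?K \<and> smooth_on ?O \<Phi>"
    using sol ext Ck unfolding smooth_on_def by blast
  show "\<exists>!\<Phi>. dirichlet_solution B \<alpha> \<Phi> \<and> \<Phi> \<in> extensional ?K"
  proof (rule ex1I, rule conjI[OF sol ext])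
    fix \<Psi> assume \<Psi>: "dirichlet_solution B \<alpha> \<Psi> \<and> \<Psi> \<in> extensional ?K"
    show "\<Psi> = \<Phi>"
    proof (rule extensionalityI[of _ ?K])
      fix x assume x: "x \<in> ?K"
      have "L b (\<Psi> x) = L b (\<Phi> x)" if "b \<in> E" for b
        by (rule dirichlet_solution_unique[OF B(1,4) E(2)[OF that] _ sol x]) (use \<Psi> in blast)
      then show "\<Psi> x = \<Phi> x" using E(3)[of "\<Psi> x"] E(3)[of "\<Phi> x"] by simp
    qed (use \<Psi> ext in auto)
  qed
qed

theorem proposition4:
  fixes U B :: "(real ^ 'n) set" and \<alpha> :: "real ^ 'n \<Rightarrow> 'v::real_normed_vector"
  assumes "open U" and "starlike U"
    and "B \<subseteq> U" and "regular_convex_closed_hypersurface B"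
    and fin_dim: "\<exists>S :: 'v set. finite S \<and> span S = UNIV"
    and "smooth_on_hypersurface B \<alpha>"
  shows "(\<exists>!\<Phi>. dirichlet_solution B \<alpha> \<Phi> \<and> \<Phi> \<in> extensional (B \<union> inside B)) \<and>
         dirichlet_solution B \<alpha> (harmonic_extension B \<alpha>) \<and>
         smooth_on (inside B) (harmonic_extension B \<alpha>)"
proof -
  have B: "compact B" "inside B \<noteq> {}" "convex (inside B)" "frontier (inside B) = B"
    using assms(4) by (auto simp: regular_convex_closed_hypersurface_def)
  obtain S :: "'v set" where S: "finite S" "span S = UNIV" using fin_dim by blast
  note ex = dirichlet_solution_exists[OF B S smooth_on_hypersurface_continuous[OF assms(6)]]
  obtain \<Phi> where \<Phi>: "dirichlet_solution B \<alpha> \<Phi>" "\<Phi> \<in> extensional (B \<union> inside B)" "smooth_on (inside B) \<Phi>"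
    using ex(2) by blast
  \<comment> \<open>Uniqueness makes the definite description return the smooth solution just
    obtained.\<close>
  have "harmonic_extension B \<alpha> = \<Phi>"
    unfolding harmonic_extension_def by (rule the1_equality[OF ex(1)]) (use \<Phi> in blast)
  then show ?thesis using ex(1) \<Phi> by simp
qed

end
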